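(* Let $L>0$, $\xi_+,\xi_-\in\mathbb R$, let $k\in L^{-1}\mathbb Z\setminus\{0\}$ be fixed, and let $\mu\in(0,\mu_c(k,\Xi))$, where $\Xi=(\xi_-,\xi_+)$. Then there exist finitely many characteristic values $$\lambda_1>\lambda_2>\dots>\lambda_M>0,\qquad 1\le M<\infty,$$ such that for each $1\le j\le M$ there exists a nontrivial function $\phi_j\in H^4((-1,1))$ satisfying, with $\lambda=\lambda_j$ and $\phi=\phi_j$, the fourth order equation $$\lambda(k^2\phi-\phi'')+\mu(\phi^{(4)}-2k^2\phi''+k^4\phi)=0\quad\text{on }(-1,1)$$ together with the boundary conditions $$\phi(\pm1)=0,\qquad \mu\phi''(1)=\xi_+\phi'(1),\qquad \mu\phi''(-1)=-\xi_-\phi'(-1).$$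
   Context: $H^s((-1,1))$ denotes the usual Sobolev space (real-valued functions), and $\tilde H^s((-1,1))=\{\phi\in H^s((-1,1)):\phi(\pm1)=0\}$ for $s\ge1$. Here $'=\frac{d}{dx_2}$, with $x_2\in(-1,1)$. The $k$-critical viscosity is $$\mu_c(k,\Xi)=\max_{\phi\in\tilde H^2((-1,1)),\ \phi\neq0}\frac{\xi_-(\phi'(-1))^2+\xi_+(\phi'(1))^2}{\int_{-1}^1\big((\phi'')^2+2k^2(\phi')^2+k^4\phi^2\big)\,dx_2}.$$ A characteristic value is a number $\lambda$ for which the stated boundary value problem has a nontrivial solution $\phi$. (The problem arises from normal mode solutions $e^{\lambda t}$ with horizontal wavenumber $k$ of the linearized Navier-Stokes equations with viscosity $\mu>0$ and constant Navier-slip coefficients $\xi_\pm$ at $x_2=\pm1$.) *)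

theory Defs
  imports "HOL-Analysis.Analysis"
begin

section \<open>Sobolev spaces on the interval (-1,1)\<close>

abbreviation I_meas :: "real measure" where
  "I_meas \<equiv> lebesgue_on {-1<..<1}"

text \<open>Elements of the function spaces are represented by functions on the real line, of which
  only the almost-everywhere class on the open interval matters.\<close>

definition L2_I :: "(real \<Rightarrow> real) set" where
  "L2_I = {f. f \<in> borel_measurable I_meas \<and> integrable I_meas (\<lambda>x. (f x)\<^sup>2)}"

definition nonzero_I :: "(real \<Rightarrow> real) \<Rightarrow> bool" where
  "nonzero_I f \<longleftrightarrow> \<not> (AE x in I_meas. f x = 0)"

definition test_function :: "(real \<Rightarrow> real) \<Rightarrow> bool" where
  "test_function \<psi> \<longleftrightarrow>
     (\<forall>n x. ((deriv ^^ n) \<psi>) field_differentiable (at x)) \<and>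
     compact (closure {x. \<psi> x \<noteq> 0}) \<and> closure {x. \<psi> x \<noteq> 0} \<subseteq> {-1<..<1}"

definition has_weak_deriv :: "nat \<Rightarrow> (real \<Rightarrow> real) \<Rightarrow> (real \<Rightarrow> real) \<Rightarrow> bool" where
  "has_weak_deriv n f g \<longleftrightarrow> f \<in> L2_I \<and> g \<in> L2_I \<and>
     (\<forall>\<psi>. test_function \<psi> \<longrightarrow>
        (\<integral>x. f x * (deriv ^^ n) \<psi> x \<partial>I_meas) = (-1) ^ n * (\<integral>x. g x * \<psi> x \<partial>I_meas))"

text \<open>The weak derivative is determined only up to null sets; some version of it is chosen.\<close>

definition weak_deriv :: "nat \<Rightarrow> (real \<Rightarrow> real) \<Rightarrow> real \<Rightarrow> real" where
  "weak_deriv n f = (SOME g. has_weak_deriv n f g)"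

definition sobolev :: "nat \<Rightarrow> (real \<Rightarrow> real) set" where
  "sobolev s = {f \<in> L2_I. \<forall>n\<le>s. \<exists>g. has_weak_deriv n f g}"

text \<open>An element of the first order space agrees almost everywhere with a function that is
  continuous up to the end points, and that function is unique on the closed interval. Point
  values, in particular the boundary values at -1 and 1, are values of this representative.\<close>

definition cont_rep :: "(real \<Rightarrow> real) \<Rightarrow> real \<Rightarrow> real" where
  "cont_rep f = (SOME h. continuous_on {-1..1} h \<and> (AE x in I_meas. h x = f x))"

definition sobolev_zero :: "nat \<Rightarrow> (real \<Rightarrow> real) set" where
  "sobolev_zero s = {\<phi> \<in> sobolev s. cont_rep \<phi> (-1) = 0 \<and> cont_rep \<phi> 1 = 0}"

abbreviation bdry_deriv :: "nat \<Rightarrow> (real \<Rightarrow> real) \<Rightarrow> real \<Rightarrow> real" where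
  "bdry_deriv n \<phi> \<equiv> cont_rep (weak_deriv n \<phi>)"

section \<open>The critical viscosity and the boundary value problem\<close>

definition rayleigh_quotient :: "real \<Rightarrow> real \<times> real \<Rightarrow> (real \<Rightarrow> real) \<Rightarrow> real" where
  "rayleigh_quotient k \<Xi> \<phi> =
     (case \<Xi> of (\<xi>m, \<xi>p) \<Rightarrow>
       (\<xi>m * (bdry_deriv 1 \<phi> (-1))\<^sup>2 + \<xi>p * (bdry_deriv 1 \<phi> 1)\<^sup>2) /
       (\<integral>x. (weak_deriv 2 \<phi> x)\<^sup>2 + 2 * k\<^sup>2 * (weak_deriv 1 \<phi> x)\<^sup>2 + k ^ 4 * (\<phi> x)\<^sup>2 \<partial>I_meas))"

text \<open>\<open>GREATEST\<close> denotes an attained maximum, not merely a supremum.\<close>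

definition critical_viscosity :: "real \<Rightarrow> real \<times> real \<Rightarrow> real" where
  "critical_viscosity k \<Xi> =
     (GREATEST r. r \<in> {rayleigh_quotient k \<Xi> \<phi> | \<phi>. \<phi> \<in> sobolev_zero 2 \<and> nonzero_I \<phi>})"

text \<open>In the following \<open>\<Xi> = (\<xi>\<^sub>-, \<xi>\<^sub>+)\<close>. The fourth derivative is only square integrable, so the
  equation is an identity between classes of functions, i.e. holds almost everywhere.\<close>

definition solves_bvp ::
  "real \<Rightarrow> real \<Rightarrow> real \<times> real \<Rightarrow> real \<Rightarrow> (real \<Rightarrow> real) \<Rightarrow> bool" where
  "solves_bvp k \<mu> \<Xi> lam \<phi> \<longleftrightarrow>
     (case \<Xi> of (\<xi>m, \<xi>p) \<Rightarrow>
       (AE x in I_meas.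
          lam * (k\<^sup>2 * \<phi> x - weak_deriv 2 \<phi> x)
          + \<mu> * (weak_deriv 4 \<phi> x - 2 * k\<^sup>2 * weak_deriv 2 \<phi> x + k ^ 4 * \<phi> x) = 0) \<and>
       cont_rep \<phi> 1 = 0 \<and> cont_rep \<phi> (-1) = 0 \<and>
       \<mu> * bdry_deriv 2 \<phi> 1 = \<xi>p * bdry_deriv 1 \<phi> 1 \<and>
       \<mu> * bdry_deriv 2 \<phi> (-1) = - \<xi>m * bdry_deriv 1 \<phi> (-1))"

definition characteristic_value :: "real \<Rightarrow> real \<Rightarrow> real \<times> real \<Rightarrow> real \<Rightarrow> bool" where
  "characteristic_value k \<mu> \<Xi> lam \<longleftrightarrow>
     (\<exists>\<phi> \<in> sobolev 4. nonzero_I \<phi> \<and> solves_bvp k \<mu> \<Xi> lam \<phi>)"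

end

theory Submission
  imports Defs "HOL-Complex_Analysis.Conformal_Mappings" "HOL-Real_Asymp.Real_Asymp"
begin

text \<open>
  The problem is reduced to linear algebra in the two numbers \<open>a = \<phi>'(-1)\<close> and \<open>b = \<phi>'(1)\<close>, written as
  \<open>b = A + B\<close>, \<open>a = B - A\<close> so that \<open>A\<close> and \<open>B\<close> belong to the even and the odd part of \<open>\<phi>\<close>. Only
  \<open>k\<^sup>2\<close> occurs, so \<open>k > 0\<close> may be assumed.

  For the critical viscosity, let \<open>v\<close> solve \<open>v'''' - 2k\<^sup>2v'' + k\<^sup>4v = 0\<close>, \<open>v(\<plusminus>1) = 0\<close> with the same boundary
  slopes as \<open>\<phi>\<close>. By partial integration \<open>\<phi> - v\<close> is orthogonal to \<open>v\<close> in the energy form, so the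
  denominator of the quotient is at least the energy of \<open>v\<close>, which is the explicit diagonal form
  \<open>2A\<^sup>2/P\<^sub>0 + 2B\<^sup>2/Q\<^sub>0\<close> (\<open>boundary_energy\<close>), whereas the numerator depends on \<open>A\<close>, \<open>B\<close> only. Hence the maximum
  exists (compactness of the circle), and for \<open>\<mu> > 0\<close> the bound \<open>\<mu> < \<mu>\<^sub>c\<close> says precisely that the quadratic
  form with matrix \<open>[[2\<mu>/P\<^sub>0 - S, -d], [-d, 2\<mu>/Q\<^sub>0 - S]]\<close>, where \<open>S = \<xi>\<^sub>+ + \<xi>\<^sub>-\<close> and \<open>d = \<xi>\<^sub>+ - \<xi>\<^sub>-\<close>, has a
  negative value (\<open>critical_viscosity_direction\<close>).

  For the boundary value problem, write \<open>\<lambda> = \<mu>(\<beta>\<^sup>2 - k\<^sup>2)\<close> with \<open>\<beta> > k\<close>. The equation factors as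
  \<open>\<mu>(D\<^sup>2 - k\<^sup>2)(D\<^sup>2 - \<beta>\<^sup>2)\<phi> = 0\<close>, and it has explicit even and odd solutions that vanish at \<open>\<plusminus>1\<close>. The slip
  conditions turn into a kernel condition for the same matrix with \<open>1/P\<^sub>0\<close>, \<open>1/Q\<^sub>0\<close> replaced by the
  functions \<open>even_stiffness k \<beta>\<close> and \<open>odd_stiffness k \<beta>\<close>. Hence a zero determinant gives a solution
  (\<open>root_imp_characteristic_value\<close>). Conversely (\<open>characteristic_value_imp_root\<close>), an arbitrary \<open>H\<^sup>4\<close> solution
  \<open>\<phi>\<close> is tested against the even and the odd solution of the equation by Green's identity, which shows
  that its own pair \<open>(A, B)\<close> lies in the kernel; and if
  \<open>(A, B) = 0\<close>, testing \<open>\<phi>\<close> against itself gives \<open>\<phi> = 0\<close> because \<open>\<lambda> > 0\<close>.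

  As \<open>\<beta> \<rightarrow> k\<close> the matrix tends to the one of the variational problem, so its least eigenvalue is negative
  for some \<open>\<beta>\<close>; as \<open>\<beta> \<rightarrow> \<infinity>\<close> the stiffnesses tend to infinity and it becomes positive. The intermediate
  value theorem yields a root. The roots are bounded, and they are zeros of a nonconstant entire function,
  so there are finitely many.

  For Sobolev functions all these identities come from \<open>weak_integration_by_parts\<close>, partial integration up
  to the end points against a continuously differentiable function. It follows from the du Bois-Reymond lemma,
  by which a weakly differentiable function is a constant plus the primitive of its weak derivative.
\<close>

section \<open>Smooth functions and test functions\<close>

text \<open>The regularity half of the definition of a test function, split off because it is stable under products
  and changes of scale of functions without compact support.\<close>

definition smooth :: "(real \<Rightarrow> real) \<Rightarrow> bool" where
  "smooth f \<longleftrightarrow> (\<forall>n x. ((deriv ^^ n) f) field_differentiable (at x))"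

text \<open>The finite-order version of smoothness, on which the product rule can be proved by induction.\<close>

definition differentiable_upto :: "nat \<Rightarrow> (real \<Rightarrow> real) \<Rightarrow> bool" where
  "differentiable_upto n f \<longleftrightarrow> (\<forall>i\<le>n. \<forall>x. ((deriv ^^ i) f) field_differentiable (at x))"

lemma smooth_iff_differentiable_upto: "smooth f \<longleftrightarrow> (\<forall>n. differentiable_upto n f)"
  unfolding smooth_def differentiable_upto_def by auto

lemma differentiable_upto_0: "differentiable_upto 0 f \<longleftrightarrow> (\<forall>x. f field_differentiable (at x))"
  unfolding differentiable_upto_def by simp

lemma differentiable_upto_Suc:
  "differentiable_upto (Suc n) f \<longleftrightarrow>
     (\<forall>x. f field_differentiable (at x)) \<and> differentiable_upto n (deriv f)"
proof -
  have "(\<forall>i\<le>Suc n. P i) \<longleftrightarrow> P 0 \<and> (\<forall>i\<le>n. P (Suc i))" for P :: "nat \<Rightarrow> bool"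
    by (metis le0 less_Suc_eq_le nat.exhaust not_less_eq_eq Suc_le_mono)
  then show ?thesis
    unfolding differentiable_upto_def by (simp add: funpow_Suc_right del: funpow.simps)
qed

lemma differentiable_upto_add:
  "differentiable_upto n f \<Longrightarrow> differentiable_upto n g \<Longrightarrow> differentiable_upto n (\<lambda>x. f x + g x)"
proof (induction n arbitrary: f g)
  case 0
  then show ?case
    unfolding differentiable_upto_0 by (auto intro: field_differentiable_add)
next
  case (Suc n)
  have "deriv (\<lambda>x. f x + g x) = (\<lambda>x. deriv f x + deriv g x)"
    using Suc.prems unfolding differentiable_upto_Suc by (intro ext deriv_add) auto
  then show ?case
    using Suc unfolding differentiable_upto_Suc by (auto intro: field_differentiable_add)
qed

lemma differentiable_upto_mono: "differentiable_upto n f \<Longrightarrow> m \<le> n \<Longrightarrow> differentiable_upto m f"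
  unfolding differentiable_upto_def by auto

lemma differentiable_upto_mult:
  "differentiable_upto n f \<Longrightarrow> differentiable_upto n g \<Longrightarrow> differentiable_upto n (\<lambda>x. f x * g x)"
proof (induction n arbitrary: f g)
  case 0
  then show ?case
    unfolding differentiable_upto_0 by (auto intro: field_differentiable_mult)
next
  case (Suc n)
  have "deriv (\<lambda>x. f x * g x) = (\<lambda>x. f x * deriv g x + deriv f x * g x)"
    using Suc.prems unfolding differentiable_upto_Suc by (intro ext deriv_mult) auto
  moreover have "differentiable_upto n (\<lambda>x. f x * deriv g x + deriv f x * g x)"
    using Suc.prems differentiable_upto_mono[of "Suc n" _ n]
    by (intro differentiable_upto_add Suc.IH) (auto simp: differentiable_upto_Suc)
  ultimately show ?case
    using Suc.prems unfolding differentiable_upto_Suc by (auto intro: field_differentiable_mult)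
qed

lemma smooth_add: "smooth f \<Longrightarrow> smooth g \<Longrightarrow> smooth (\<lambda>x. f x + g x)"
  unfolding smooth_iff_differentiable_upto by (auto intro: differentiable_upto_add)

lemma smooth_mult: "smooth f \<Longrightarrow> smooth g \<Longrightarrow> smooth (\<lambda>x. f x * g x)"
  unfolding smooth_iff_differentiable_upto by (auto intro: differentiable_upto_mult)

lemma smooth_family:
  assumes "\<And>n x. (F n has_real_derivative F (Suc n) x) (at x)"
  shows "smooth (F 0)"
proof -
  have *: "(deriv ^^ n) (F 0) = F n" for n
  proof (induction n)
    case (Suc n)
    then show ?case
      using DERIV_imp_deriv[OF assms[of n]] by auto
  qed simp
  then show "smooth (F 0)"
    using assms by (auto simp: smooth_def field_differentiable_def)
qed

lemma smooth_has_derivative: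
  "smooth f \<Longrightarrow> ((deriv ^^ n) f has_real_derivative (deriv ^^ Suc n) f x) (at x)"
  unfolding smooth_def by (simp add: DERIV_deriv_iff_field_differentiable)

lemma smooth_deriv: "smooth f \<Longrightarrow> smooth (deriv f)"
  unfolding smooth_def by (metis funpow_Suc_right comp_apply)

lemma smooth_continuous: "smooth f \<Longrightarrow> continuous_on S f"
  by (rule DERIV_continuous_on[of S f "deriv f"], rule has_field_derivative_at_within)
    (use smooth_has_derivative[of f 0] in simp)

lemma smooth_const: "smooth (\<lambda>x. c)"
proof -
  have "smooth ((\<lambda>n x. if n = (0::nat) then c else 0) 0)"
    by (rule smooth_family) simp
  then show ?thesis by simp
qed

lemma smooth_affine:
  assumes "smooth f"
  shows "smooth (\<lambda>x. f (c * x + d))"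
proof -
  have "smooth ((\<lambda>n x. c ^ n * (deriv ^^ n) f (c * x + d)) 0)"
  proof (rule smooth_family)
    fix n x
    have "((\<lambda>x. (deriv ^^ n) f (c * x + d)) has_real_derivative
            (deriv ^^ Suc n) f (c * x + d) * c) (at x)"
      by (rule DERIV_chain2[OF smooth_has_derivative[OF assms]])
        (auto intro!: derivative_eq_intros)
    then show "((\<lambda>x. c ^ n * (deriv ^^ n) f (c * x + d)) has_real_derivative
            c ^ Suc n * (deriv ^^ Suc n) f (c * x + d)) (at x)"
      by (auto intro!: derivative_eq_intros)
  qed
  then show ?thesis by simp
qed

definition flat :: "real \<Rightarrow> real" where
  "flat x = (if x > 0 then exp (- 1 / x) else 0)"

text \<open>Away from the origin, the derivatives of \<open>exp (-1/x)\<close> are \<open>p(1/x) exp (-1/x)\<close> with polynomials \<open>p\<close>, and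
  differentiation acts on \<open>p\<close> by \<open>p \<mapsto> y\<^sup>2 (p - p')\<close>. At the origin the difference quotient tends to
  zero since the exponential beats every polynomial in \<open>y = 1/x\<close>.\<close>

lemma smooth_flat: "smooth flat"
proof -
  define F where "F p x = (if x > 0 then poly p (1 / x) * exp (- 1 / x) else 0)" for p and x :: real
  define r where "r p = [:0, 0, 1:] * (p - pderiv p)" for p :: "real poly"
  have decay: "((\<lambda>x. x * poly p x * exp (- x)) \<longlongrightarrow> 0) at_top" for p :: "real poly"
  proof (induction p)
    case (pCons c p)
    have "((\<lambda>x. x * c * exp (- x) + x * (x * poly p x * exp (- x))) \<longlongrightarrow> 0) at_top"
    proof -
      have 1: "((\<lambda>x. x * c * exp (- x)) \<longlongrightarrow> 0) at_top" by real_asymp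
      have "((\<lambda>x::real. x ^ k * exp (- x)) \<longlongrightarrow> 0) at_top" for k :: nat
        using tendsto_power_div_exp_0[of k] by (simp only: exp_minus divide_inverse)
      then have "((\<lambda>x. \<Sum>i\<le>degree p. coeff p i * (x ^ (i + 2) * exp (- x))) \<longlongrightarrow> (\<Sum>i\<le>degree p. coeff p i * 0)) at_top"
        by (intro tendsto_sum tendsto_mult tendsto_const)
      moreover have "x * (x * poly p x * exp (- x)) = (\<Sum>i\<le>degree p. coeff p i * (x ^ (i + 2) * exp (- x)))" for x
        by (simp add: poly_altdef sum_distrib_left sum_distrib_right power_add power2_eq_square mult_ac)
      ultimately have "((\<lambda>x. x * (x * poly p x * exp (- x))) \<longlongrightarrow> 0) at_top" by simp
      from tendsto_add[OF 1 this] show ?thesis by simp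
    qed
    then show ?case by (simp add: algebra_simps)
  qed simp
  have "(F p has_real_derivative F (r p) x) (at x)" for p x
  proof -
    consider "x > 0" | "x < 0" | "x = 0" by linarith
    then show ?thesis
    proof cases
      case 1
      have "((\<lambda>x. poly p (1 / x) * exp (- 1 / x)) has_real_derivative
             poly (r p) (1 / x) * exp (- 1 / x)) (at x)"
        using 1 by (auto intro!: derivative_eq_intros DERIV_chain2[OF poly_DERIV]
            simp: r_def field_simps power2_eq_square)
      then have "(F p has_real_derivative poly (r p) (1 / x) * exp (- 1 / x)) (at x)"
        by (rule DERIV_cong_ev[THEN iffD1, rotated 3])
          (use eventually_nhds_in_open[of "{0<..}" x] 1 in \<open>auto simp: F_def elim: eventually_mono\<close>)
      then show ?thesis using 1 by (simp add: F_def)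
    next
      case 2
      have "((\<lambda>x. 0) has_real_derivative 0) (at x)" by simp
      then have "(F p has_real_derivative 0) (at x)"
        by (rule DERIV_cong_ev[THEN iffD1, rotated 3])
          (use eventually_nhds_in_open[of "{..<0}" x] 2 in \<open>auto simp: F_def elim: eventually_mono\<close>)
      then show ?thesis using 2 by (simp add: F_def)
    next
      case 3
      have "((\<lambda>h. F p h / h) \<longlongrightarrow> 0) (at_right 0)"
      proof -
        have "((\<lambda>h. (inverse h) * poly p (inverse h) * exp (- inverse h)) \<longlongrightarrow> 0) (at_right 0)"
          by (rule filterlim_compose[OF decay filterlim_inverse_at_top_right])
        then show ?thesis
          by (rule Lim_transform_eventually)
            (auto simp: F_def eventually_at_filter field_simps)
      qed
      moreover have "((\<lambda>h. F p h / h) \<longlongrightarrow> 0) (at_left 0)"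
        by (rule Lim_transform_eventually[OF tendsto_const])
          (auto simp: F_def eventually_at_filter)
      ultimately have "((\<lambda>h. F p h / h) \<longlongrightarrow> 0) (at 0)"
        by (simp add: filterlim_at_split)
      then show ?thesis
        using 3 by (simp add: DERIV_def F_def)
    qed
  qed
  then have "smooth ((\<lambda>n. F ((r ^^ n) 1)) 0)"
    by (intro smooth_family) auto
  moreover have "F 1 = flat"
    by (auto simp: F_def flat_def)
  ultimately show ?thesis by simp
qed

text \<open>Compact support inside the open interval means vanishing outside some \<open>[-c, c]\<close> with \<open>c < 1\<close>; this
  form is easier to check and to combine.\<close>

lemma test_function_iff:
  "test_function \<psi> \<longleftrightarrow> smooth \<psi> \<and> (\<exists>c<1. \<forall>x. \<psi> x \<noteq> 0 \<longrightarrow> \<bar>x\<bar> \<le> c)"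
proof (intro iffI conjI)
  assume t: "test_function \<psi>"
  then show "smooth \<psi>" unfolding test_function_def smooth_def by blast
  let ?K = "closure {x. \<psi> x \<noteq> 0}"
  have K: "compact ?K" "?K \<subseteq> {-1<..<1}" using t unfolding test_function_def by auto
  show "\<exists>c<1. \<forall>x. \<psi> x \<noteq> 0 \<longrightarrow> \<bar>x\<bar> \<le> c"
  proof (cases "?K = {}")
    case True
    then show ?thesis by (intro exI[of _ 0]) auto
  next
    case False
    have "\<exists>m\<in>?K. \<forall>y\<in>?K. \<bar>y\<bar> \<le> \<bar>m\<bar>"
      by (rule continuous_attains_sup[OF K(1) False]) (intro continuous_intros)
    then obtain m where m: "m \<in> ?K" "\<And>y. y \<in> ?K \<Longrightarrow> \<bar>y\<bar> \<le> \<bar>m\<bar>"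
      by blast
    moreover have "\<bar>m\<bar> < 1" using subsetD[OF K(2) m(1)] by (simp add: abs_less_iff)
    ultimately show ?thesis
      using closure_subset[of "{x. \<psi> x \<noteq> 0}"] by (intro exI[of _ "\<bar>m\<bar>"]) auto
  qed
next
  assume "smooth \<psi> \<and> (\<exists>c<1. \<forall>x. \<psi> x \<noteq> 0 \<longrightarrow> \<bar>x\<bar> \<le> c)"
  then obtain c where c: "smooth \<psi>" "c < 1" "\<And>x. \<psi> x \<noteq> 0 \<Longrightarrow> \<bar>x\<bar> \<le> c" by blast
  have "closure {x. \<psi> x \<noteq> 0} \<subseteq> {-c..c}"
    by (rule closure_minimal) (use c(3) in \<open>auto simp: abs_le_iff\<close>, force)
  moreover from this have "compact (closure {x. \<psi> x \<noteq> 0})"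
    by (meson bounded_closed_interval bounded_subset closed_closure compact_eq_bounded_closed)
  ultimately show "test_function \<psi>"
    using c(1,2) unfolding test_function_def smooth_def by fastforce
qed

lemma test_function_smooth: "test_function \<psi> \<Longrightarrow> smooth \<psi>"
  by (simp add: test_function_iff)

lemma test_function_boundary:
  assumes "test_function \<psi>" shows "\<psi> 1 = 0" "\<psi> (-1) = 0"
  using assms unfolding test_function_iff by force+

lemma test_function_deriv:
  assumes "test_function \<psi>" shows "test_function (deriv \<psi>)"
proof -
  from assms obtain c where c: "smooth \<psi>" "c < 1" "\<And>x. \<psi> x \<noteq> 0 \<Longrightarrow> \<bar>x\<bar> \<le> c"
    unfolding test_function_iff by blast
  have "deriv \<psi> x = 0" if "\<bar>x\<bar> > c" for x
  proof -
    have "open {y. \<bar>y\<bar> > c}" by (intro open_Collect_less continuous_intros)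
    then have "\<forall>\<^sub>F y in nhds x. \<psi> y = 0"
      using that c(3) by (intro eventually_mono[OF eventually_nhds_in_open[of "{y. \<bar>y\<bar> > c}" x]]) force+
    then have "deriv \<psi> x = deriv (\<lambda>x. 0) x"
      by (rule deriv_cong_ev) simp
    then show ?thesis by simp
  qed
  then show ?thesis
    using c(1,2) smooth_deriv[OF c(1)] unfolding test_function_iff by (meson not_le)
qed

lemma test_function_lincomb:
  assumes "test_function \<psi>" "test_function \<eta>"
  shows "test_function (\<lambda>x. a * \<psi> x + b * \<eta> x)"
proof -
  from assms obtain c d where c: "smooth \<psi>" "c < 1" "\<And>x. \<psi> x \<noteq> 0 \<Longrightarrow> \<bar>x\<bar> \<le> c"
    and d: "smooth \<eta>" "d < 1" "\<And>x. \<eta> x \<noteq> 0 \<Longrightarrow> \<bar>x\<bar> \<le> d"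
    unfolding test_function_iff by blast
  have "smooth (\<lambda>x. a * \<psi> x + b * \<eta> x)"
    by (intro smooth_add smooth_mult smooth_const c d)
  moreover have "\<bar>x\<bar> \<le> max c d" if "a * \<psi> x + b * \<eta> x \<noteq> 0" for x
    using that c(3)[of x] d(3)[of x] by force
  ultimately show ?thesis
    using c(2) d(2) unfolding test_function_iff by (intro conjI exI[of _ "max c d"]) auto
qed

text \<open>Smooth functions supported in \<open>[a, b]\<close> that increase to the indicator of \<open>(a, b)\<close>: rescaling the argument
  of \<open>flat\<close> amounts to taking \<open>n\<close>-th roots of its values.\<close>

definition bump :: "real \<Rightarrow> real \<Rightarrow> nat \<Rightarrow> real \<Rightarrow> real" where
  "bump a b n x = flat (real n * (x - a)) * flat (real n * (b - x))"

lemma bump_bounds: "0 \<le> bump a b n x" "bump a b n x \<le> 1"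
proof -
  have "0 \<le> flat t" "flat t \<le> 1" for t by (auto simp: flat_def)
  then show "0 \<le> bump a b n x" "bump a b n x \<le> 1"
    by (auto simp: bump_def intro: mult_le_one)
qed

lemma test_function_bump:
  assumes "-1 < a" "b < 1" "a < b"
  shows "test_function (bump a b n)"
proof -
  have "smooth (\<lambda>x. flat (real n * x + (- real n * a)) * flat (- real n * x + real n * b))"
    by (intro smooth_mult smooth_affine smooth_flat)
  then have "smooth (bump a b n)"
    unfolding bump_def[abs_def] by (simp add: algebra_simps)
  moreover have "\<bar>x\<bar> \<le> max \<bar>a\<bar> \<bar>b\<bar>" if "bump a b n x \<noteq> 0" for x
  proof -
    have "real n * (x - a) > 0" "real n * (b - x) > 0"
      using that by (auto simp: bump_def flat_def split: if_splits)
    then have "x > a" "x < b" by (auto simp: zero_less_mult_iff)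
    then show ?thesis by auto
  qed
  ultimately show ?thesis
    using assms unfolding test_function_iff by (intro conjI exI[of _ "max \<bar>a\<bar> \<bar>b\<bar>"]) auto
qed

lemma bump_tendsto_indicator: "(\<lambda>n. bump a b n x) \<longlonglongrightarrow> indicator {a<..<b} x"
proof -
  have pos: "(\<lambda>n. flat (real n * t)) \<longlonglongrightarrow> 1" if "t > 0" for t
  proof -
    have "(\<lambda>n. exp (- 1 / (real n * t))) \<longlonglongrightarrow> 1" using that by real_asymp
    then show ?thesis
      by (rule Lim_transform_eventually)
        (rule eventually_mono[OF eventually_gt_at_top[of 0]], use that in \<open>auto simp: flat_def\<close>)
  qed
  have nonpos: "flat (real n * t) = 0" if "t \<le> 0" for t n
    using that by (auto simp: flat_def mult_nonneg_nonpos not_less)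
  show ?thesis
  proof (cases "a < x \<and> x < b")
    case True
    then have "(\<lambda>n. flat (real n * (x - a)) * flat (real n * (b - x))) \<longlonglongrightarrow> 1 * 1"
      by (intro tendsto_mult pos) auto
    then show ?thesis using True by (simp add: bump_def)
  next
    case False
    then have "bump a b n x = 0" for n
      using nonpos[of "x - a" n] nonpos[of "b - x" n] by (auto simp: bump_def)
    then show ?thesis using False by simp
  qed
qed

section \<open>Integration over the interval\<close>

lemma finite_measure_I: "finite_measure I_meas"
  by (rule finite_measure_lebesgue_on) simp

lemma integral_I_eq:
  fixes f :: "real \<Rightarrow> real"
  assumes "integrable I_meas f"
  shows "f integrable_on {-1..1}" "(\<integral>x. f x \<partial>I_meas) = integral {-1..1} f"
proof -
  have "f integrable_on {-1<..<1}" "(\<integral>x. f x \<partial>I_meas) = integral {-1<..<1} f"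
    using assms by (auto simp: lebesgue_integral_eq_integral intro: integrable_on_lebesgue_on)
  then show "f integrable_on {-1..1}" "(\<integral>x. f x \<partial>I_meas) = integral {-1..1} f"
    by (simp_all add: integral_open_interval_real integrable_on_open_interval_real)
qed

lemma integral_I_restrict:
  fixes f :: "real \<Rightarrow> real"
  assumes "integrable I_meas f" "S \<subseteq> {-1<..<1}" "S \<in> sets borel"
  shows "(\<integral>x. (if x \<in> S then f x else 0) \<partial>I_meas) = integral S f"
proof -
  have S: "S \<in> sets lebesgue" using assms(3) by auto
  have "set_integrable lebesgue {-1<..<1} f"
    using assms(1) by (simp add: integrable_restrict_space set_integrable_def)
  then have "set_integrable lebesgue S f"
    by (rule set_integrable_subset[OF _ S assms(2)])
  then have "integrable (lebesgue_on S) f"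
    using S by (simp add: integrable_restrict_space set_integrable_def)
  then show ?thesis
    using integral_restrict[OF assms(2) S, of f] lebesgue_integral_eq_integral[OF _ S] by simp
qed

lemma measurable_I_continuous:
  fixes f :: "real \<Rightarrow> real"
  assumes "continuous_on {-1..1} f" shows "f \<in> borel_measurable I_meas"
proof (rule continuous_imp_measurable_on_sets_lebesgue)
  show "continuous_on {-1<..<1} f" by (rule continuous_on_subset[OF assms]) auto
qed simp

lemma continuous_bounded_I:
  fixes f :: "real \<Rightarrow> real"
  assumes "continuous_on {-1..1} f"
  obtains B where "B > 0" "\<And>x. x \<in> {-1..1} \<Longrightarrow> \<bar>f x\<bar> \<le> B"
proof -
  have "bounded (f ` {-1..1})"
    by (intro compact_imp_bounded compact_continuous_image assms compact_Icc)
  then show ?thesis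
    using that unfolding bounded_pos by auto
qed

lemma integrable_I_mult_continuous:
  fixes f g :: "real \<Rightarrow> real"
  assumes "integrable I_meas g" "continuous_on {-1..1} f"
  shows "integrable I_meas (\<lambda>x. g x * f x)"
proof -
  obtain B where B: "B > 0" "\<And>x. x \<in> {-1..1} \<Longrightarrow> \<bar>f x\<bar> \<le> B"
    using continuous_bounded_I[OF assms(2)] by blast
  show ?thesis
  proof (rule Bochner_Integration.integrable_bound)
    show "integrable I_meas (\<lambda>x. B * \<bar>g x\<bar>)" using assms(1) by auto
    show "(\<lambda>x. g x * f x) \<in> borel_measurable I_meas"
      using assms(1) measurable_I_continuous[OF assms(2)] by auto
    show "AE x in I_meas. norm (g x * f x) \<le> norm (B * \<bar>g x\<bar>)"
      using B by (intro AE_I2) (auto simp: abs_mult mult.commute[of B] intro!: mult_left_mono)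
  qed
qed

lemma integrable_I_const: "integrable I_meas (\<lambda>x. c :: real)"
  using finite_measure.integrable_const[OF finite_measure_I] .

lemma integrable_I_continuous:
  fixes f :: "real \<Rightarrow> real"
  assumes "continuous_on {-1..1} f" shows "integrable I_meas f"
  using integrable_I_mult_continuous[OF integrable_I_const[of 1] assms] by simp

lemma L2_I_continuous: "continuous_on {-1..1} f \<Longrightarrow> f \<in> L2_I"
  unfolding L2_I_def
  by (auto intro!: measurable_I_continuous integrable_I_continuous continuous_intros)

lemma L2_I_mult_integrable:
  assumes "f \<in> L2_I" "g \<in> L2_I" shows "integrable I_meas (\<lambda>x. f x * g x)"
proof (rule Bochner_Integration.integrable_bound)
  show "integrable I_meas (\<lambda>x. (f x)\<^sup>2 + (g x)\<^sup>2)"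
    using assms unfolding L2_I_def by auto
  show "(\<lambda>x. f x * g x) \<in> borel_measurable I_meas"
    using assms unfolding L2_I_def by auto
  have "\<bar>a * b\<bar> \<le> a\<^sup>2 + b\<^sup>2" for a b :: real
    using sum_squares_bound[of "\<bar>a\<bar>" "\<bar>b\<bar>"] mult_nonneg_nonneg[of "\<bar>a\<bar>" "\<bar>b\<bar>"]
    unfolding abs_mult by (simp del: mult_nonneg_nonneg)
  then show "AE x in I_meas. norm (f x * g x) \<le> norm ((f x)\<^sup>2 + (g x)\<^sup>2)"
    by simp
qed

lemma L2_I_integrable: "f \<in> L2_I \<Longrightarrow> integrable I_meas f"
  using L2_I_mult_integrable[of f "\<lambda>x. 1"] L2_I_continuous[of "\<lambda>x. 1"] by simp

lemma AE_I_iff: "(AE x in I_meas. P x) \<longleftrightarrow> (AE x in lebesgue. x \<in> {-1<..<1} \<longrightarrow> P x)"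
  by (rule AE_restrict_space_iff) simp

text \<open>Almost everywhere on the open interval means everywhere on the closed one for continuous functions;
  this makes the continuous representative, and so the boundary values, unique.\<close>

lemma continuous_AE_zero:
  fixes f :: "real \<Rightarrow> real"
  assumes "continuous_on {-1..1} f" "AE x in I_meas. f x = 0" "x \<in> {-1..1}"
  shows "f x = 0"
proof -
  have "(\<integral>x. (f x)\<^sup>2 \<partial>I_meas) = 0"
    by (rule integral_eq_zero_AE) (use assms(2) in auto)
  then have "integral {-1..1} (\<lambda>x. (f x)\<^sup>2) = 0"
    using integral_I_eq(2)[of "\<lambda>x. (f x)\<^sup>2"] assms(1)
    by (simp add: integrable_I_continuous continuous_intros)
  moreover have "continuous_on {-1..1} (\<lambda>x. (f x)\<^sup>2)"
    by (intro continuous_intros assms)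
  ultimately show ?thesis
    using integral_eq_0_iff[of "-1" 1 "\<lambda>x. (f x)\<^sup>2"] assms(3) by simp
qed

lemma cont_rep_eq:
  assumes "continuous_on {-1..1} h" "AE x in I_meas. h x = f x"
  shows "AE x in I_meas. cont_rep f x = f x"
    and "x \<in> {-1..1} \<Longrightarrow> cont_rep f x = h x"
proof -
  have *: "continuous_on {-1..1} (cont_rep f) \<and> (AE x in I_meas. cont_rep f x = f x)"
    unfolding cont_rep_def by (rule someI[of _ h]) (use assms in blast)
  then show "AE x in I_meas. cont_rep f x = f x" by blast
  assume x: "x \<in> {-1..1}"
  have "cont_rep f x - h x = 0"
  proof (rule continuous_AE_zero[OF _ _ x])
    show "continuous_on {-1..1} (\<lambda>x. cont_rep f x - h x)"
      using * assms(1) by (auto intro: continuous_intros)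
    show "AE x in I_meas. cont_rep f x - h x = 0"
      using conjunct2[OF *] assms(2) by eventually_elim simp
  qed
  then show "cont_rep f x = h x" by simp
qed

section \<open>The fundamental lemma of the calculus of variations\<close>

text \<open>Dominated convergence along the bumps turns the hypothesis into \<open>\<integral>\<^sub>a\<^sup>b w = 0\<close> for all subintervals, and
  Lebesgue's differentiation theorem then gives \<open>w = 0\<close> almost everywhere.\<close>

lemma fundamental_lemma:
  assumes w: "integrable I_meas w"
    and zero: "\<And>\<psi>. test_function \<psi> \<Longrightarrow> (\<integral>x. w x * \<psi> x \<partial>I_meas) = 0"
  shows "AE x in I_meas. w x = 0"
proof -
  have ind: "(\<integral>x. w x * indicator {a<..<b} x \<partial>I_meas) = 0" if "-1 < a" "a < b" "b < 1" for a b
  proof -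
    have "(\<lambda>n. \<integral>x. w x * bump a b n x \<partial>I_meas) \<longlonglongrightarrow> (\<integral>x. w x * indicator {a<..<b} x \<partial>I_meas)"
    proof (rule integral_dominated_convergence[where w = "\<lambda>x. \<bar>w x\<bar>"])
      have "indicat_real {a<..<b} \<in> borel_measurable I_meas"
        by (intro measurable_restrict_space1 measurable_completion borel_measurable_indicator) simp
      then show "(\<lambda>x. w x * indicator {a<..<b} x) \<in> borel_measurable I_meas"
        using w by auto
      have "bump a b n \<in> borel_measurable I_meas" for n
        by (intro measurable_I_continuous smooth_continuous test_function_smooth test_function_bump that)
      then show "(\<lambda>x. w x * bump a b n x) \<in> borel_measurable I_meas" for n
        using w by auto
      show "integrable I_meas (\<lambda>x. \<bar>w x\<bar>)" using w by auto
      show "AE x in I_meas. (\<lambda>n. w x * bump a b n x) \<longlonglongrightarrow> w x * indicator {a<..<b} x"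
        by (intro AE_I2 tendsto_mult tendsto_const bump_tendsto_indicator)
      show "AE x in I_meas. norm (w x * bump a b n x) \<le> \<bar>w x\<bar>" for n
        using bump_bounds[of a b n] by (intro AE_I2) (auto simp: abs_mult intro: mult_left_le)
    qed
    moreover have "(\<integral>x. w x * bump a b n x \<partial>I_meas) = 0" for n
      by (intro zero test_function_bump that)
    ultimately show ?thesis using LIMSEQ_unique[OF _ tendsto_const] by fastforce
  qed
  define w0 where "w0 x = (if x \<in> {-1<..<1} then w x else 0)" for x
  have w0: "integrable lebesgue w0"
    unfolding w0_def using w by (subst Lebesgue_Measure.integrable_restrict_UNIV) auto
  then have "w0 integrable_on UNIV"
    using integrable_on_lebesgue_on[of UNIV w0] by (simp add: lebesgue_on_UNIV_eq)
  then have "w0 integrable_on cbox a b" for a b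
    by (rule integrable_on_subcbox) simp
  then obtain N where N: "negligible N"
    "\<And>x e. \<lbrakk>x \<notin> N; 0 < e\<rbrakk> \<Longrightarrow> \<exists>d>0. \<forall>h. 0 < h \<and> h < d \<longrightarrow>
       norm (integral (cbox x (x + h *\<^sub>R One)) w0 /\<^sub>R h ^ DIM(real) - w0 x) < e"
    using integrable_ccontinuous_explicit[of w0] by blast
  have int0: "integral {a..b} w0 = 0" if "-1 < a" "a < b" "b < 1" for a b
  proof -
    have "integral {a..b} w0 = integral {a<..<b} w0"
      by (simp add: integral_open_interval_real)
    also have "\<dots> = integral {a<..<b} w"
      using that by (intro Henstock_Kurzweil_Integration.integral_cong) (auto simp: w0_def)
    also have "\<dots> = (\<integral>x. (if x \<in> {a<..<b} then w x else 0) \<partial>I_meas)"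
      using that by (intro integral_I_restrict[symmetric] w) auto
    also have "\<dots> = (\<integral>x. w x * indicator {a<..<b} x \<partial>I_meas)"
      by (intro Bochner_Integration.integral_cong) (auto simp: indicator_def)
    finally show ?thesis using ind[OF that] by simp
  qed
  have "w x = 0" if "x \<in> {-1<..<1}" "x \<notin> N" for x
  proof (rule ccontr)
    assume "w x \<noteq> 0"
    with N(2)[of x "\<bar>w x\<bar>"] that obtain d where d: "d > 0"
      "\<And>h. 0 < h \<Longrightarrow> h < d \<Longrightarrow> norm (integral (cbox x (x + h *\<^sub>R One)) w0 /\<^sub>R h ^ DIM(real) - w0 x) < \<bar>w x\<bar>"
      by auto
    define h where "h = min (d / 2) ((1 - x) / 2)"
    have h: "h > 0" "h < d" "x + h < 1" using d(1) that by (auto simp: h_def min_def field_simps)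
    have "integral (cbox x (x + h *\<^sub>R One)) w0 = 0"
      using int0[of x "x + h"] h that by simp
    then show False using d(2)[OF h(1,2)] that by (simp add: w0_def)
  qed
  then have "AE x in lebesgue. x \<in> {-1<..<1} \<longrightarrow> w x = 0"
    using N(1) by (intro AE_I'[of N]) (auto simp: negligible_iff_null_sets)
  then show ?thesis by (simp add: AE_I_iff)
qed

text \<open>The mean value condition makes the primitive that vanishes at the left end vanish at the right end as well,
  hence outside the support of \<open>\<eta>\<close>.\<close>

lemma test_function_antiderivative:
  assumes \<eta>: "test_function \<eta>" and zero: "(\<integral>x. \<eta> x \<partial>I_meas) = 0"
  obtains \<psi> where "test_function \<psi>" "deriv \<psi> = \<eta>"
proof -
  from \<eta> obtain c where c: "smooth \<eta>" "c < 1" "\<And>x. \<eta> x \<noteq> 0 \<Longrightarrow> \<bar>x\<bar> \<le> c"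
    unfolding test_function_iff by blast
  have "\<exists>F. \<forall>x::real. -\<infinity> < ereal x \<longrightarrow> ereal x < \<infinity> \<longrightarrow> (F has_vector_derivative \<eta> x) (at x)"
    by (rule einterval_antiderivative)
      (use smooth_continuous[OF c(1), of UNIV] in \<open>auto simp: continuous_on_eq_continuous_at\<close>)
  then obtain F where F: "\<And>x. (F has_real_derivative \<eta> x) (at x)"
    by (auto simp: has_real_derivative_iff_has_vector_derivative)
  define \<psi> where "\<psi> x = F x - F (-1)" for x
  have d\<psi>: "(\<psi> has_real_derivative \<eta> x) (at x)" for x
    unfolding \<psi>_def using F by (auto intro!: derivative_eq_intros)
  have deriv: "deriv \<psi> = \<eta>"
    using d\<psi> by (auto intro: DERIV_imp_deriv)
  have "(\<eta> has_integral (\<psi> 1 - \<psi> (-1))) {-1..1}"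
    by (rule fundamental_theorem_of_calculus)
      (simp_all add: has_field_derivative_at_within[OF d\<psi>] flip: has_real_derivative_iff_has_vector_derivative)
  moreover have "integral {-1..1} \<eta> = 0"
    using zero integral_I_eq(2)[OF integrable_I_continuous[OF smooth_continuous[OF c(1)]]] by simp
  ultimately have \<psi>1: "\<psi> 1 = \<psi> (-1)" by (simp add: has_integral_iff)
  have const: "\<exists>a. \<forall>x\<in>S. \<psi> x = a" if "convex S" "\<And>x. x \<in> S \<Longrightarrow> \<bar>x\<bar> > c" for S
  proof (rule has_field_derivative_zero_constant[OF that(1)])
    fix x assume "x \<in> S"
    then have "\<eta> x = 0" using that(2)[of x] c(3)[of x] by linarith
    then show "(\<psi> has_real_derivative 0) (at x within S)"
      using d\<psi>[of x] by (auto intro: has_field_derivative_at_within)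
  qed
  have out: "\<psi> x = 0" if "\<bar>x\<bar> > c" for x
  proof (cases "x > c")
    case True
    obtain a where "\<And>y. y > c \<Longrightarrow> \<psi> y = a"
      using const[of "{c<..}"] by fastforce
    then have "\<psi> x = \<psi> 1" using True c(2) by simp
    then show ?thesis using \<psi>1 by (simp add: \<psi>_def)
  next
    case False
    obtain a where "\<And>y. y < - c \<Longrightarrow> \<psi> y = a"
      using const[of "{..<-c}"] by fastforce
    then have "\<psi> x = \<psi> (-1)" using False that c(2) by simp
    then show ?thesis by (simp add: \<psi>_def)
  qed
  have "(deriv ^^ n) \<psi> field_differentiable at x" for n x
  proof (cases n)
    case 0
    then show ?thesis using d\<psi> by (auto simp: field_differentiable_def)
  next
    case (Suc m)
    then show ?thesis using c(1) unfolding smooth_def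
      by (simp add: funpow_Suc_right deriv del: funpow.simps)
  qed
  then have "test_function \<psi>"
    unfolding test_function_iff smooth_def using out c(2) by (meson not_le)
  then show ?thesis using deriv that by blast
qed

text \<open>A test function of mean zero is a derivative of a test function. After subtracting a multiple of one fixed
  bump \<open>\<eta>\<close>, every test function has mean zero, so \<open>w\<close> integrates against all test functions like the
  constant \<open>\<integral> w \<eta> / \<integral> \<eta>\<close>.\<close>

lemma du_Bois_Reymond:
  assumes w: "integrable I_meas w"
    and zero: "\<And>\<psi>. test_function \<psi> \<Longrightarrow> (\<integral>x. w x * deriv \<psi> x \<partial>I_meas) = 0"
  shows "\<exists>c. AE x in I_meas. w x = c"
proof -
  define \<eta> where "\<eta> = bump (-1/2) (1/2) 1"
  have \<eta>: "test_function \<eta>" unfolding \<eta>_def by (rule test_function_bump) auto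
  have test_int: "integrable I_meas \<psi>" "integrable I_meas (\<lambda>x. w x * \<psi> x)" if "test_function \<psi>" for \<psi>
    using smooth_continuous[OF test_function_smooth[OF that]]
    by (auto intro: integrable_I_continuous integrable_I_mult_continuous[OF w])
  define m where "m = (\<integral>x. \<eta> x \<partial>I_meas)"
  have "m \<noteq> 0"
  proof
    assume "m = 0"
    then have "AE x in I_meas. \<eta> x = 0"
      using integral_nonneg_eq_0_iff_AE[OF test_int(1)[OF \<eta>]] bump_bounds(1) unfolding m_def
      by (simp add: \<eta>_def)
    then have "\<eta> 0 = 0"
      by (rule continuous_AE_zero[OF smooth_continuous[OF test_function_smooth[OF \<eta>]]]) simp
    then show False by (simp add: \<eta>_def bump_def flat_def)
  qed
  define c where "c = (\<integral>x. w x * \<eta> x \<partial>I_meas) / m"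
  have "AE x in I_meas. w x - c = 0"
  proof (rule fundamental_lemma)
    show "integrable I_meas (\<lambda>x. w x - c)" using w integrable_I_const by auto
    fix \<psi> assume \<psi>: "test_function \<psi>"
    define s where "s = (\<integral>x. \<psi> x \<partial>I_meas)"
    have t: "test_function (\<lambda>x. 1 * \<psi> x + (- s / m) * \<eta> x)"
      by (rule test_function_lincomb[OF \<psi> \<eta>])
    have "(\<integral>x. 1 * \<psi> x + (- s / m) * \<eta> x \<partial>I_meas) = 0"
      using \<open>m \<noteq> 0\<close> test_int(1)[OF \<psi>] test_int(1)[OF \<eta>] by (simp add: s_def m_def)
    from test_function_antiderivative[OF t this] obtain \<theta> where
      \<theta>: "test_function \<theta>" "deriv \<theta> = (\<lambda>x. 1 * \<psi> x + (- s / m) * \<eta> x)" .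
    have "0 = (\<integral>x. w x * \<psi> x + (- s / m) * (w x * \<eta> x) \<partial>I_meas)"
      using zero[OF \<theta>(1)] unfolding \<theta>(2) by (simp add: algebra_simps)
    also have "\<dots> = (\<integral>x. w x * \<psi> x \<partial>I_meas) - c * s"
      using test_int(2)[OF \<psi>] test_int(2)[OF \<eta>] by (simp add: c_def)
    also have "\<dots> = (\<integral>x. (w x - c) * \<psi> x \<partial>I_meas)"
      using test_int[OF \<psi>] by (simp add: s_def left_diff_distrib)
    finally show "(\<integral>x. (w x - c) * \<psi> x \<partial>I_meas) = 0" by simp
  qed
  then show ?thesis by (intro exI[of _ c]) (auto elim: eventually_mono)
qed

section \<open>Absolutely continuous representatives\<close>

definition primitive :: "(real \<Rightarrow> real) \<Rightarrow> real \<Rightarrow> real" where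
  "primitive g x = integral {-1..x} g"

lemma primitive_continuous: "integrable I_meas g \<Longrightarrow> continuous_on {-1..1} (primitive g)"
  unfolding primitive_def[abs_def] by (intro indefinite_integral_continuous_1 integral_I_eq)

lemma integral_I_derivative:
  assumes "\<And>x. x \<in> {-1..1} \<Longrightarrow> (v has_real_derivative v' x) (at x within {-1..1})"
    and "continuous_on {-1..1} v'"
  shows "(\<integral>x. v' x \<partial>I_meas) = v 1 - v (-1)"
proof -
  have "(v' has_integral (v 1 - v (-1))) {-1..1}"
    by (rule fundamental_theorem_of_calculus)
      (use assms(1) in \<open>auto simp flip: has_real_derivative_iff_has_vector_derivative\<close>)
  then show ?thesis
    using integral_I_eq(2)[OF integrable_I_continuous[OF assms(2)]] by (simp add: has_integral_iff)
qed

text \<open>Partial integration for the primitive of a merely integrable function, by exchanging the order of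
  integration over the triangle \<open>t < x\<close>.\<close>

lemma integral_primitive_mult:
  assumes g: "integrable I_meas g"
    and v: "\<And>x. x \<in> {-1..1} \<Longrightarrow> (v has_real_derivative v' x) (at x within {-1..1})"
    and v': "continuous_on {-1..1} v'"
  shows "(\<integral>x. primitive g x * v' x \<partial>I_meas) = primitive g 1 * v 1 - (\<integral>x. g x * v x \<partial>I_meas)"
proof -
  interpret finite_measure I_meas by (rule finite_measure_I)
  interpret pair_sigma_finite I_meas I_meas ..
  have iv': "integrable I_meas v'" by (rule integrable_I_continuous[OF v'])
  note [measurable] = borel_measurable_integrable[OF g] measurable_I_continuous[OF v']
  have [measurable]: "(\<lambda>x. x) \<in> borel_measurable I_meas"
    by (intro measurable_I_continuous continuous_intros)
  have "integrable (I_meas \<Otimes>\<^sub>M I_meas) (\<lambda>(t, x). g t * v' x)"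
  proof (rule Fubini_integrable)
    show "(\<lambda>(t, x). g t * v' x) \<in> borel_measurable (I_meas \<Otimes>\<^sub>M I_meas)" by measurable
    show "integrable I_meas (\<lambda>t. \<integral>x. norm (case (t, x) of (t, x) \<Rightarrow> g t * v' x) \<partial>I_meas)"
      using g by (simp add: abs_mult)
    show "AE t in I_meas. integrable I_meas (\<lambda>x. case (t, x) of (t, x) \<Rightarrow> g t * v' x)"
      using iv' by simp
  qed
  then have int: "integrable (I_meas \<Otimes>\<^sub>M I_meas) (\<lambda>(t, x). if t < x then g t * v' x else 0)"
    by (rule Bochner_Integration.integrable_bound) (auto simp: split_beta)
  have "(\<integral>x. primitive g x * v' x \<partial>I_meas)
      = (\<integral>x. (\<integral>t. (if t < x then g t * v' x else 0) \<partial>I_meas) \<partial>I_meas)"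
  proof (rule Bochner_Integration.integral_cong[OF refl])
    fix x assume x: "x \<in> space I_meas"
    have "primitive g x = integral {-1<..<x} g"
      by (simp add: primitive_def integral_open_interval_real)
    also have "\<dots> = (\<integral>t. (if t \<in> {-1<..<x} then g t else 0) \<partial>I_meas)"
      using x by (intro integral_I_restrict[symmetric] g) auto
    also have "\<dots> = (\<integral>t. (if t < x then g t else 0) \<partial>I_meas)"
      by (intro Bochner_Integration.integral_cong) auto
    finally have "primitive g x * v' x = (\<integral>t. (if t < x then g t else 0) * v' x \<partial>I_meas)"
      by simp
    also have "\<dots> = (\<integral>t. (if t < x then g t * v' x else 0) \<partial>I_meas)"
      by (intro Bochner_Integration.integral_cong) auto
    finally show "primitive g x * v' x = (\<integral>t. (if t < x then g t * v' x else 0) \<partial>I_meas)" .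
  qed
  also have "\<dots> = (\<integral>t. (\<integral>x. (if t < x then g t * v' x else 0) \<partial>I_meas) \<partial>I_meas)"
    by (rule Fubini_integral[OF int])
  also have "\<dots> = (\<integral>t. g t * (v 1 - v t) \<partial>I_meas)"
  proof (rule Bochner_Integration.integral_cong[OF refl])
    fix t assume t: "t \<in> space I_meas"
    have "(\<integral>x. (if t < x then g t * v' x else 0) \<partial>I_meas)
        = (\<integral>x. g t * (if x \<in> {t<..<1} then v' x else 0) \<partial>I_meas)"
      by (intro Bochner_Integration.integral_cong) auto
    also have "\<dots> = g t * (\<integral>x. (if x \<in> {t<..<1} then v' x else 0) \<partial>I_meas)"
      by (rule integral_mult_right_zero)
    also have "(\<integral>x. (if x \<in> {t<..<1} then v' x else 0) \<partial>I_meas) = integral {t<..<1} v'"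
      by (rule integral_I_restrict[OF iv']) (use t in auto)
    also have "integral {t<..<1} v' = v 1 - v t"
    proof -
      have "(v' has_integral (v 1 - v t)) {t..1}"
      proof (rule fundamental_theorem_of_calculus)
        show "t \<le> 1" using t by simp
        show "(v has_vector_derivative v' x) (at x within {t..1})" if "x \<in> {t..1}" for x
          using v[of x] that t
          by (auto simp flip: has_real_derivative_iff_has_vector_derivative intro: DERIV_subset)
      qed
      then show ?thesis
        by (simp add: integral_open_interval_real has_integral_iff)
    qed
    finally show "(\<integral>x. (if t < x then g t * v' x else 0) \<partial>I_meas) = g t * (v 1 - v t)" .
  qed
  also have "\<dots> = primitive g 1 * v 1 - (\<integral>x. g x * v x \<partial>I_meas)"
  proof -
    have "continuous_on {-1..1} v" using v by (rule DERIV_continuous_on)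
    then have "integrable I_meas (\<lambda>x. g x * v x)" by (rule integrable_I_mult_continuous[OF g])
    then show ?thesis
      using g integral_I_eq(2)[OF g] by (simp add: right_diff_distrib primitive_def)
  qed
  finally show ?thesis .
qed

section \<open>Weak derivatives and integration by parts up to the boundary\<close>

lemma has_weak_derivD:
  assumes "has_weak_deriv n f g"
  shows "f \<in> L2_I" "g \<in> L2_I"
    and "test_function \<psi> \<Longrightarrow>
      (\<integral>x. f x * (deriv ^^ n) \<psi> x \<partial>I_meas) = (-1) ^ n * (\<integral>x. g x * \<psi> x \<partial>I_meas)"
  using assms unfolding has_weak_deriv_def by auto

lemma L2_I_mult_continuous:
  "f \<in> L2_I \<Longrightarrow> continuous_on {-1..1} v \<Longrightarrow> integrable I_meas (\<lambda>x. f x * v x)"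
  by (intro integrable_I_mult_continuous L2_I_integrable)

lemma test_function_continuous: "test_function \<psi> \<Longrightarrow> continuous_on S \<psi>"
  by (intro smooth_continuous test_function_smooth)

lemma weak_deriv_unique:
  assumes g: "has_weak_deriv n f g" and h: "has_weak_deriv n f h"
  shows "AE x in I_meas. g x = h x"
proof -
  have "AE x in I_meas. g x - h x = 0"
  proof (rule fundamental_lemma)
    show "integrable I_meas (\<lambda>x. g x - h x)"
      using L2_I_integrable has_weak_derivD(2)[OF g] has_weak_derivD(2)[OF h] by auto
    fix \<psi> assume \<psi>: "test_function \<psi>"
    note c = test_function_continuous[OF \<psi>, of "{-1..1}"]
    show "(\<integral>x. (g x - h x) * \<psi> x \<partial>I_meas) = 0"
      using L2_I_mult_continuous[OF has_weak_derivD(2)[OF g] c]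
        L2_I_mult_continuous[OF has_weak_derivD(2)[OF h] c]
        has_weak_derivD(3)[OF g \<psi>] has_weak_derivD(3)[OF h \<psi>]
      by (simp add: left_diff_distrib)
  qed
  then show ?thesis by (auto elim: eventually_mono)
qed

text \<open>By the partial integration above, \<open>f\<close> minus the primitive of its weak derivative annihilates all
  derivatives of test functions.\<close>

lemma weak_deriv_primitive:
  assumes "has_weak_deriv 1 f g"
  shows "\<exists>c. AE x in I_meas. c + primitive g x = f x"
proof -
  note L2 = has_weak_derivD(1,2)[OF assms]
  have int: "integrable I_meas f" "integrable I_meas g" using L2 by (auto intro: L2_I_integrable)
  have G: "continuous_on {-1..1} (primitive g)" by (rule primitive_continuous[OF int(2)])
  have "\<exists>c. AE x in I_meas. f x - primitive g x = c"
  proof (rule du_Bois_Reymond)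
    show "integrable I_meas (\<lambda>x. f x - primitive g x)"
      using int(1) integrable_I_continuous[OF G] by auto
    fix \<psi> assume \<psi>: "test_function \<psi>"
    have c: "continuous_on {-1..1} (deriv \<psi>)"
      by (rule test_function_continuous[OF test_function_deriv[OF \<psi>]])
    have "(\<psi> has_real_derivative deriv \<psi> x) (at x within {-1..1})" for x
      using smooth_has_derivative[OF test_function_smooth[OF \<psi>], of 0]
      by (simp add: has_field_derivative_at_within)
    from integral_primitive_mult[OF int(2) this c]
    have "(\<integral>x. primitive g x * deriv \<psi> x \<partial>I_meas) = - (\<integral>x. g x * \<psi> x \<partial>I_meas)"
      by (simp add: test_function_boundary[OF \<psi>])
    moreover have "(\<integral>x. f x * deriv \<psi> x \<partial>I_meas) = - (\<integral>x. g x * \<psi> x \<partial>I_meas)"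
      using has_weak_derivD(3)[OF assms \<psi>] by simp
    ultimately show "(\<integral>x. (f x - primitive g x) * deriv \<psi> x \<partial>I_meas) = 0"
      using L2_I_mult_continuous[OF L2(1) c] L2_I_mult_continuous[OF L2_I_continuous[OF G] c]
      by (simp add: left_diff_distrib)
  qed
  then obtain c where "AE x in I_meas. f x - primitive g x = c" ..
  then show ?thesis by (intro exI[of _ c]) (auto elim: eventually_mono)
qed

text \<open>A weakly differentiable function has the absolutely continuous representative \<open>c + \<integral> g\<close>, so the choice made
  in \<open>cont_rep\<close> is over a nonempty set and is forced on the closed interval.\<close>

lemma
  assumes "has_weak_deriv 1 f g"
  shows cont_rep_AE: "AE x in I_meas. cont_rep f x = f x"
    and cont_rep_primitive:
      "x \<in> {-1..1} \<Longrightarrow> cont_rep f x = cont_rep f (-1) + primitive g x"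
    and cont_rep_continuous: "continuous_on {-1..1} (cont_rep f)"
proof -
  have int: "integrable I_meas g" by (rule L2_I_integrable[OF has_weak_derivD(2)[OF assms]])
  obtain c where c: "AE x in I_meas. c + primitive g x = f x"
    using weak_deriv_primitive[OF assms] ..
  have cont: "continuous_on {-1..1} (\<lambda>x. c + primitive g x)"
    by (intro continuous_intros primitive_continuous int)
  show "AE x in I_meas. cont_rep f x = f x" by (rule cont_rep_eq(1)[OF cont c])
  note eq = cont_rep_eq(2)[OF cont c]
  show "cont_rep f x = cont_rep f (-1) + primitive g x" if "x \<in> {-1..1}"
    using eq[OF that] eq[of "-1"] by (simp add: primitive_def)
  show "continuous_on {-1..1} (cont_rep f)"
    using cont eq by (subst continuous_on_cong[OF refl]) auto
qed

text \<open>Test functions are replaced by arbitrary continuously differentiable functions, at the price of boundary terms.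
  The identities for Sobolev functions below rest on this one.\<close>

lemma weak_integration_by_parts:
  assumes f: "has_weak_deriv 1 f g"
    and v: "\<And>x. x \<in> {-1..1} \<Longrightarrow> (v has_real_derivative v' x) (at x within {-1..1})"
    and v': "continuous_on {-1..1} v'"
  shows "(\<integral>x. g x * v x \<partial>I_meas) =
    cont_rep f 1 * v 1 - cont_rep f (-1) * v (-1) - (\<integral>x. f x * v' x \<partial>I_meas)"
proof -
  have int: "integrable I_meas g" by (rule L2_I_integrable[OF has_weak_derivD(2)[OF f]])
  have G: "integrable I_meas (\<lambda>x. primitive g x * v' x)"
    by (intro integrable_I_continuous continuous_intros primitive_continuous int v')
  have "(\<integral>x. f x * v' x \<partial>I_meas) =
      (\<integral>x. cont_rep f (-1) * v' x + primitive g x * v' x \<partial>I_meas)"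
  proof (rule integral_cong_AE)
    show "(\<lambda>x. f x * v' x) \<in> borel_measurable I_meas"
      using L2_I_mult_continuous[OF has_weak_derivD(1)[OF f] v'] by auto
    show "(\<lambda>x. cont_rep f (-1) * v' x + primitive g x * v' x) \<in> borel_measurable I_meas"
      by (intro measurable_I_continuous continuous_intros primitive_continuous int v')
    show "AE x in I_meas. f x * v' x = cont_rep f (-1) * v' x + primitive g x * v' x"
      using cont_rep_AE[OF f] AE_space
    proof eventually_elim
      case (elim x)
      then show ?case
        using cont_rep_primitive[OF f, of x] by (simp flip: distrib_right)
    qed
  qed
  also have "\<dots> = cont_rep f (-1) * (v 1 - v (-1)) + (primitive g 1 * v 1 - (\<integral>x. g x * v x \<partial>I_meas))"
    using G integrable_I_continuous[OF v'] integral_I_derivative[OF v v']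
      integral_primitive_mult[OF int v v'] by simp
  finally show ?thesis
    using cont_rep_primitive[OF f, of 1] by (simp add: algebra_simps)
qed

lemma has_weak_deriv_weak_deriv:
  assumes "f \<in> sobolev s" "n \<le> s" shows "has_weak_deriv n f (weak_deriv n f)"
proof -
  have "\<exists>g. has_weak_deriv n f g" using assms unfolding sobolev_def by auto
  then show ?thesis unfolding weak_deriv_def by (rule someI_ex)
qed

text \<open>Testing with the derivative of a test function reduces higher weak derivatives to iterated first ones, so
  that the lemmas on first weak derivatives apply at every order.\<close>

lemma has_weak_deriv_Suc_iff:
  assumes "has_weak_deriv n f g"
  shows "has_weak_deriv (Suc n) f h \<longleftrightarrow> has_weak_deriv 1 g h"
proof -
  have "(\<integral>x. f x * (deriv ^^ Suc n) \<psi> x \<partial>I_meas) = (-1) ^ n * (\<integral>x. g x * deriv \<psi> x \<partial>I_meas)"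
    if "test_function \<psi>" for \<psi>
    using has_weak_derivD(3)[OF assms test_function_deriv[OF that]]
    by (simp add: funpow_Suc_right del: funpow.simps)
  moreover have "(-1) ^ n * a = (-1) ^ Suc n * b \<longleftrightarrow> a = - b" for a b :: real
    by (cases "even n") auto
  ultimately show ?thesis
    using has_weak_derivD(1,2)[OF assms] unfolding has_weak_deriv_def by auto
qed

lemma sobolev_weak_deriv_1:
  "f \<in> sobolev s \<Longrightarrow> 1 \<le> s \<Longrightarrow> has_weak_deriv 1 f (weak_deriv 1 f)"
  by (rule has_weak_deriv_weak_deriv)

lemma sobolev_weak_deriv_Suc:
  "f \<in> sobolev s \<Longrightarrow> Suc n \<le> s \<Longrightarrow> has_weak_deriv 1 (weak_deriv n f) (weak_deriv (Suc n) f)"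
  using has_weak_deriv_Suc_iff[OF has_weak_deriv_weak_deriv[of f s n]]
    has_weak_deriv_weak_deriv[of f s "Suc n"] by simp

text \<open>If the weak derivative is itself weakly differentiable, the representative is classically continuously
  differentiable and may serve as the smooth factor in partial integration.\<close>

lemma cont_rep_has_derivative:
  assumes f: "has_weak_deriv 1 f g" and g: "has_weak_deriv 1 g h" and x: "x \<in> {-1..1}"
  shows "(cont_rep f has_real_derivative cont_rep g x) (at x within {-1..1})"
proof -
  have "integral {-1..y} g = integral {-1..y} (cont_rep g)" if "y \<in> {-1..1}" for y
  proof -
    have "(\<integral>x. (if x \<in> {-1<..<y} then g x else 0) \<partial>I_meas)
        = (\<integral>x. (if x \<in> {-1<..<y} then cont_rep g x else 0) \<partial>I_meas)"
    proof (rule integral_cong_AE)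
      have [measurable]: "{-1<..<y} \<in> sets lebesgue" by auto
      have *: "{-1<..<y} \<inter> space I_meas \<in> sets I_meas" by (auto simp: sets_restrict_space)
      show "(\<lambda>x. if x \<in> {-1<..<y} then g x else 0) \<in> borel_measurable I_meas"
        "(\<lambda>x. if x \<in> {-1<..<y} then cont_rep g x else 0) \<in> borel_measurable I_meas"
        by (rule measurable_If_set[OF borel_measurable_integrable[OF
              L2_I_integrable[OF has_weak_derivD(2)[OF f]]] borel_measurable_const *],
            rule measurable_If_set[OF measurable_I_continuous[OF cont_rep_continuous[OF g]]
              borel_measurable_const *])
      show "AE x in I_meas. (if x \<in> {-1<..<y} then g x else 0) =
          (if x \<in> {-1<..<y} then cont_rep g x else 0)"
        using cont_rep_AE[OF g] by eventually_elim auto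
    qed
    moreover have "{-1<..<y} \<subseteq> {-1<..<1}" using that by auto
    ultimately have "integral {-1<..<y} g = integral {-1<..<y} (cont_rep g)"
      using integral_I_restrict[OF L2_I_integrable[OF has_weak_derivD(2)[OF f]], of "{-1<..<y}"]
        integral_I_restrict[OF integrable_I_continuous[OF cont_rep_continuous[OF g]], of "{-1<..<y}"]
      by (simp only: borel_open open_greaterThanLessThan)
    then show ?thesis by (simp add: integral_open_interval_real)
  qed
  then have eq: "cont_rep f y = cont_rep f (-1) + integral {-1..y} (cont_rep g)" if "y \<in> {-1..1}" for y
    using cont_rep_primitive[OF f that] that by (simp add: primitive_def)
  have "((\<lambda>y. cont_rep f (-1) + integral {-1..y} (cont_rep g)) has_real_derivative cont_rep g x)
      (at x within {-1..1})"
    using integral_has_real_derivative[OF cont_rep_continuous[OF g] x]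
    by (auto intro!: derivative_eq_intros)
  then show ?thesis
    by (rule has_field_derivative_transform_within[OF _ zero_less_one x]) (rule eq[symmetric])
qed

lemma has_weak_deriv_classical:
  assumes "\<And>x. x \<in> {-1..1} \<Longrightarrow> (v has_real_derivative v' x) (at x within {-1..1})"
    and v': "continuous_on {-1..1} v'"
  shows "has_weak_deriv 1 v v'"
proof -
  have v: "continuous_on {-1..1} v" using assms(1) by (rule DERIV_continuous_on)
  have "(\<integral>x. v x * deriv \<psi> x \<partial>I_meas) = - (\<integral>x. v' x * \<psi> x \<partial>I_meas)"
    if \<psi>: "test_function \<psi>" for \<psi>
  proof -
    note c = test_function_continuous[OF \<psi>, of "{-1..1}"]
      test_function_continuous[OF test_function_deriv[OF \<psi>], of "{-1..1}"]
    have "(\<integral>x. v x * deriv \<psi> x + v' x * \<psi> x \<partial>I_meas) = v 1 * \<psi> 1 - v (-1) * \<psi> (-1)"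
    proof (rule integral_I_derivative)
      fix x :: real assume "x \<in> {-1..1}"
      moreover have "(\<psi> has_real_derivative deriv \<psi> x) (at x within {-1..1})"
        using smooth_has_derivative[OF test_function_smooth[OF \<psi>], of 0]
        by (simp add: has_field_derivative_at_within)
      ultimately show "((\<lambda>x. v x * \<psi> x) has_real_derivative v x * deriv \<psi> x + v' x * \<psi> x)
          (at x within {-1..1})"
        using assms(1) by (auto intro!: derivative_eq_intros)
    qed (intro continuous_intros v v' c)
    moreover have "integrable I_meas (\<lambda>x. v x * deriv \<psi> x)" "integrable I_meas (\<lambda>x. v' x * \<psi> x)"
      by (intro integrable_I_continuous continuous_intros v v' c)+
    ultimately show ?thesis by (simp add: test_function_boundary[OF \<psi>])
  qed
  then show ?thesis
    unfolding has_weak_deriv_def by (auto intro: L2_I_continuous v v')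
qed

text \<open>For classically differentiable functions the chosen weak derivatives and boundary values are the classical
  ones. The functions \<open>d n\<close> are the successive derivatives of \<open>d 0\<close>.\<close>

lemma
  assumes der: "\<And>n x. n < s \<Longrightarrow> x \<in> {-1..1} \<Longrightarrow>
      (d n has_real_derivative d (Suc n) x) (at x within {-1..1})"
    and cont: "continuous_on {-1..1} (d s)"
  shows classical_sobolev: "d 0 \<in> sobolev s"
    and classical_weak_deriv: "n \<le> s \<Longrightarrow> AE x in I_meas. weak_deriv n (d 0) x = d n x"
    and classical_bdry_deriv: "n \<le> s \<Longrightarrow> x \<in> {-1..1} \<Longrightarrow> bdry_deriv n (d 0) x = d n x"
proof -
  have cont': "continuous_on {-1..1} (d n)" if "n \<le> s" for n
    using that der[of n] cont DERIV_continuous_on[of "{-1..1}" "d n" "d (Suc n)"]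
    by (cases "n = s") auto
  have d: "has_weak_deriv n (d 0) (d n)" if "n \<le> s" for n
    using that
  proof (induction n)
    case 0
    then show ?case
      using cont'[of 0] by (auto simp: has_weak_deriv_def intro: L2_I_continuous)
  next
    case (Suc n)
    then have "has_weak_deriv 1 (d n) (d (Suc n))"
      by (intro has_weak_deriv_classical der cont') auto
    then show ?case using Suc has_weak_deriv_Suc_iff[of n "d 0" "d n"] by auto
  qed
  then show sob: "d 0 \<in> sobolev s"
    unfolding sobolev_def using cont'[of 0] by (auto intro: L2_I_continuous)
  show ae: "AE x in I_meas. weak_deriv n (d 0) x = d n x" if "n \<le> s" for n
    by (rule weak_deriv_unique[OF has_weak_deriv_weak_deriv[OF sob that] d[OF that]])
  show "bdry_deriv n (d 0) x = d n x" if "n \<le> s" "x \<in> {-1..1}"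
    by (rule cont_rep_eq(2)[OF cont'[OF that(1)] _ that(2)])
      (use ae[OF that(1)] in \<open>auto elim: eventually_mono\<close>)
qed

lemma cont_rep_classical: "continuous_on {-1..1} f \<Longrightarrow> x \<in> {-1..1} \<Longrightarrow> cont_rep f x = f x"
  by (rule cont_rep_eq(2)) auto

text \<open>Nontriviality is read off from the boundary: a function that vanishes almost everywhere has zero
  weak derivatives, hence zero boundary values of every order.\<close>

lemma nonzero_I_if_bdry_deriv:
  assumes \<phi>: "\<phi> \<in> sobolev s" "n \<le> s" and x: "x \<in> {-1..1}" "bdry_deriv n \<phi> x \<noteq> 0"
  shows "nonzero_I \<phi>"
  unfolding nonzero_I_def
proof
  assume z: "AE x in I_meas. \<phi> x = 0"
  have "(\<integral>x. \<phi> x * (deriv ^^ n) \<psi> x \<partial>I_meas) = 0" for \<psi>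
    by (rule integral_eq_zero_AE) (use z in \<open>auto elim: eventually_mono\<close>)
  then have "has_weak_deriv n \<phi> (\<lambda>x. 0)"
    using \<phi>(1) by (auto simp: has_weak_deriv_def sobolev_def intro: L2_I_continuous)
  from weak_deriv_unique[OF this has_weak_deriv_weak_deriv[OF \<phi>]]
  have "bdry_deriv n \<phi> x = 0"
    by (intro cont_rep_eq(2)[OF _ _ x(1)]) (auto elim: eventually_mono)
  then show False using x(2) by simp
qed

section \<open>The critical viscosity\<close>

definition bending_energy :: "real \<Rightarrow> (real \<Rightarrow> real) \<Rightarrow> real" where
  "bending_energy k \<phi> =
     (\<integral>x. (weak_deriv 2 \<phi> x)\<^sup>2 + 2 * k\<^sup>2 * (weak_deriv 1 \<phi> x)\<^sup>2 + k ^ 4 * (\<phi> x)\<^sup>2 \<partial>I_meas)"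

text \<open>A function together with all its derivatives. Carrying the derivatives as data gives closed formulas
  for the explicit solutions instead of iterated \<open>deriv\<close>.\<close>

locale smooth_chain =
  fixes v :: "nat \<Rightarrow> real \<Rightarrow> real"
  assumes der: "\<And>n x. (v n has_real_derivative v (Suc n) x) (at x)"
begin

lemma der_within: "(v n has_real_derivative v (Suc n) x) (at x within S)"
  by (rule has_field_derivative_at_within[OF der])

lemma cont: "continuous_on S (v n)"
  by (rule DERIV_continuous_on) (rule der_within)

lemmas in_sobolev = classical_sobolev[of _ v, OF der_within cont]
lemmas weak_deriv_eq = classical_weak_deriv[of _ v, OF der_within cont]
lemmas bdry_deriv_eq = classical_bdry_deriv[of _ v, OF der_within cont]
lemmas cont_rep_0 = cont_rep_classical[OF cont[of _ 0]]

lemma parts: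
  assumes "has_weak_deriv 1 f g"
  shows "(\<integral>x. g x * v n x \<partial>I_meas) =
    cont_rep f 1 * v n 1 - cont_rep f (-1) * v n (-1) - (\<integral>x. f x * v (Suc n) x \<partial>I_meas)"
  by (rule weak_integration_by_parts[OF assms der_within cont])

lemma L2_mult: "f \<in> L2_I \<Longrightarrow> integrable I_meas (\<lambda>x. f x * v n x)"
  by (rule L2_I_mult_continuous[OF _ cont])

end

lemma sobolev_L2:
  assumes "f \<in> sobolev s" shows "f \<in> L2_I" "n \<le> s \<Longrightarrow> weak_deriv n f \<in> L2_I"
  using assms has_weak_derivD(2)[OF has_weak_deriv_weak_deriv] by (auto simp: sobolev_def)

lemma (in smooth_chain) parts_2:
  assumes \<phi>: "\<phi> \<in> sobolev_zero s" "2 \<le> s"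
  shows "(\<integral>x. weak_deriv 1 \<phi> x * v n x \<partial>I_meas) = - (\<integral>x. \<phi> x * v (Suc n) x \<partial>I_meas)"
    and "(\<integral>x. weak_deriv 2 \<phi> x * v n x \<partial>I_meas) =
      bdry_deriv 1 \<phi> 1 * v n 1 - bdry_deriv 1 \<phi> (-1) * v n (-1) + (\<integral>x. \<phi> x * v (n + 2) x \<partial>I_meas)"
proof -
  have s: "\<phi> \<in> sobolev s" "cont_rep \<phi> 1 = 0" "cont_rep \<phi> (-1) = 0"
    using \<phi>(1) by (auto simp: sobolev_zero_def)
  have 1: "has_weak_deriv 1 \<phi> (weak_deriv 1 \<phi>)"
    using \<phi>(2) s(1) by (intro sobolev_weak_deriv_1) auto
  have 2: "has_weak_deriv 1 (weak_deriv 1 \<phi>) (weak_deriv 2 \<phi>)"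
    using sobolev_weak_deriv_Suc[OF s(1), of 1] \<phi>(2) by (simp add: numeral_2_eq_2)
  show *: "(\<integral>x. weak_deriv 1 \<phi> x * v n x \<partial>I_meas) = - (\<integral>x. \<phi> x * v (Suc n) x \<partial>I_meas)" for n
    using parts[OF 1, of n] s by simp
  show "(\<integral>x. weak_deriv 2 \<phi> x * v n x \<partial>I_meas) =
      bdry_deriv 1 \<phi> 1 * v n 1 - bdry_deriv 1 \<phi> (-1) * v n (-1) + (\<integral>x. \<phi> x * v (n + 2) x \<partial>I_meas)"
    using parts[OF 2, of n] *[of "Suc n"] by (simp add: numeral_2_eq_2)
qed

text \<open>The Euler-Lagrange identity of the energy: if \<open>v\<close> satisfies the homogeneous equation, its energy product
  with \<open>\<phi>\<close> depends only on the boundary slopes of \<open>\<phi>\<close>.\<close>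

lemma (in smooth_chain) bending_form:
  assumes \<phi>: "\<phi> \<in> sobolev_zero s" "2 \<le> s"
  shows "(\<integral>x. weak_deriv 2 \<phi> x * v 2 x + 2 * k\<^sup>2 * (weak_deriv 1 \<phi> x * v 1 x)
            + k ^ 4 * (\<phi> x * v 0 x) \<partial>I_meas) =
    bdry_deriv 1 \<phi> 1 * v 2 1 - bdry_deriv 1 \<phi> (-1) * v 2 (-1)
      + (\<integral>x. \<phi> x * (v 4 x - 2 * k\<^sup>2 * v 2 x + k ^ 4 * v 0 x) \<partial>I_meas)"
proof -
  have s: "\<phi> \<in> sobolev s" using \<phi>(1) by (auto simp: sobolev_zero_def)
  have int [simp]: "integrable I_meas (\<lambda>x. \<phi> x * v n x)"
    "integrable I_meas (\<lambda>x. weak_deriv 1 \<phi> x * v n x)"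
    "integrable I_meas (\<lambda>x. weak_deriv 2 \<phi> x * v n x)" for n
    using sobolev_L2[OF s] \<phi>(2) by (auto intro: L2_mult)
  have "(\<integral>x. \<phi> x * (v 4 x - 2 * k\<^sup>2 * v 2 x + k ^ 4 * v 0 x) \<partial>I_meas) =
      (\<integral>x. \<phi> x * v 4 x - 2 * k\<^sup>2 * (\<phi> x * v 2 x) + k ^ 4 * (\<phi> x * v 0 x) \<partial>I_meas)"
    by (intro Bochner_Integration.integral_cong) (auto simp: algebra_simps)
  also have "\<dots> = (\<integral>x. \<phi> x * v 4 x \<partial>I_meas) - 2 * k\<^sup>2 * (\<integral>x. \<phi> x * v 2 x \<partial>I_meas)
      + k ^ 4 * (\<integral>x. \<phi> x * v 0 x \<partial>I_meas)"
    by simp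
  also have "(\<integral>x. \<phi> x * v 4 x \<partial>I_meas) = (\<integral>x. weak_deriv 2 \<phi> x * v 2 x \<partial>I_meas)
      - (bdry_deriv 1 \<phi> 1 * v 2 1 - bdry_deriv 1 \<phi> (-1) * v 2 (-1))"
    using parts_2(2)[OF \<phi>, of 2] by simp
  also have "(\<integral>x. \<phi> x * v 2 x \<partial>I_meas) = - (\<integral>x. weak_deriv 1 \<phi> x * v 1 x \<partial>I_meas)"
    using parts_2(1)[OF \<phi>, of 1] by (simp only: Suc_1 minus_minus)
  finally show ?thesis by (simp del: One_nat_def)
qed

text \<open>The \<open>n\<close>-th derivative of \<open>sinh (c x)\<close> for \<open>p = 0\<close> and of \<open>cosh (c x)\<close> for \<open>p = 1\<close>.\<close>

definition hyp :: "nat \<Rightarrow> real \<Rightarrow> nat \<Rightarrow> real \<Rightarrow> real" where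
  "hyp p c n x = c ^ n * (if even (n + p) then sinh (c * x) else cosh (c * x))"

text \<open>The \<open>n\<close>-th derivative of \<open>x \<mapsto> x sinh (c x)\<close> respectively \<open>x \<mapsto> x cosh (c x)\<close>. For \<open>n = 0\<close> the truncated index
  \<open>n - 1\<close> is harmless because of the factor \<open>n\<close>.\<close>

definition xhyp :: "nat \<Rightarrow> real \<Rightarrow> nat \<Rightarrow> real \<Rightarrow> real" where
  "xhyp p c n x = x * hyp p c n x + real n * hyp p c (n - 1) x"

lemma hyp_derivative: "(hyp p c n has_real_derivative hyp p c (Suc n) x) (at x)"
  unfolding hyp_def[abs_def] by (auto intro!: derivative_eq_intros)

lemma xhyp_derivative: "(xhyp p c n has_real_derivative xhyp p c (Suc n) x) (at x)"
proof (cases n)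
  case 0
  then show ?thesis
    unfolding xhyp_def[abs_def] by (auto intro!: derivative_eq_intros hyp_derivative)
next
  case (Suc m)
  then show ?thesis
    unfolding xhyp_def[abs_def]
    by (auto intro!: derivative_eq_intros hyp_derivative simp: algebra_simps)
qed

text \<open>The ratio \<open>v'(1) / v''(1)\<close> for the even, respectively odd, solution of \<open>(D\<^sup>2 - k\<^sup>2)\<^sup>2 v = 0\<close> that vanishes
  at \<open>\<plusminus>1\<close>. These are the numbers \<open>P\<^sub>0\<close> and \<open>Q\<^sub>0\<close>.\<close>

definition even_compliance :: "real \<Rightarrow> real" where
  "even_compliance k = (sinh k * cosh k + k) / (2 * k * (cosh k)\<^sup>2)"

definition odd_compliance :: "real \<Rightarrow> real" where
  "odd_compliance k = (sinh k * cosh k - k) / (2 * k * (sinh k)\<^sup>2)"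

lemma less_sinh_cosh:
  assumes "k > (0::real)" shows "k < sinh k * cosh k"
proof -
  have "(sinh has_real_derivative cosh x) (at x)" for x :: real
    by (auto intro!: derivative_eq_intros)
  then obtain z where "0 < z" "z < k" "sinh k - sinh 0 = (k - 0) * cosh z"
    using MVT2[of 0 k sinh cosh] assms by auto
  then have "k < sinh k"
    using assms cosh_real_strict_mono[of 0 z] by simp
  also have "sinh k \<le> sinh k * cosh k"
    using assms cosh_real_ge_1[of k] by (simp add: mult_le_cancel_left1)
  finally show ?thesis .
qed

lemma compliance_pos:
  assumes "k > 0" shows "even_compliance k > 0" "odd_compliance k > 0"
  using assms less_sinh_cosh[OF assms]
  by (auto simp: even_compliance_def odd_compliance_def)

text \<open>The energy minimizer with boundary slopes \<open>v'(1) = A + B\<close> and \<open>v'(-1) = B - A\<close>. The double root \<open>k\<close> of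
  the equation produces the terms \<open>x sinh (k x)\<close> and \<open>x cosh (k x)\<close>; the constants normalize the slope at
  \<open>1\<close> of the even and the odd part.\<close>

definition extremal :: "real \<Rightarrow> real \<Rightarrow> real \<Rightarrow> nat \<Rightarrow> real \<Rightarrow> real" where
  "extremal k A B n x =
     A * (sinh k * cosh k / (sinh k * cosh k + k)) * (xhyp 0 k n x / sinh k - hyp 1 k n x / cosh k)
   + B * (sinh k * cosh k / (sinh k * cosh k - k)) * (xhyp 1 k n x / cosh k - hyp 0 k n x / sinh k)"

interpretation extremal: smooth_chain "extremal k A B" for k A B
  by unfold_locales (unfold extremal_def[abs_def],
    intro DERIV_add DERIV_cmult DERIV_diff DERIV_cdivide hyp_derivative xhyp_derivative)

lemma extremal_ode:
  "extremal k A B 4 x - 2 * k\<^sup>2 * extremal k A B 2 x + k ^ 4 * extremal k A B 0 x = 0"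
proof -
  have h: "hyp p k 4 x - 2 * k\<^sup>2 * hyp p k 2 x + k ^ 4 * hyp p k 0 x = 0" for p
    by (simp add: hyp_def algebra_simps flip: power_add)
  have g: "xhyp p k 4 x - 2 * k\<^sup>2 * xhyp p k 2 x + k ^ 4 * xhyp p k 0 x = 0" for p
    by (simp add: xhyp_def hyp_def algebra_simps power2_eq_square power3_eq_cube power4_eq_xxxx)
  define a where "a = A * (sinh k * cosh k / (sinh k * cosh k + k))"
  define b where "b = B * (sinh k * cosh k / (sinh k * cosh k - k))"
  have "extremal k A B 4 x - 2 * k\<^sup>2 * extremal k A B 2 x + k ^ 4 * extremal k A B 0 x =
      a * ((xhyp 0 k 4 x - 2 * k\<^sup>2 * xhyp 0 k 2 x + k ^ 4 * xhyp 0 k 0 x) / sinh k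
         - (hyp 1 k 4 x - 2 * k\<^sup>2 * hyp 1 k 2 x + k ^ 4 * hyp 1 k 0 x) / cosh k)
    + b * ((xhyp 1 k 4 x - 2 * k\<^sup>2 * xhyp 1 k 2 x + k ^ 4 * xhyp 1 k 0 x) / cosh k
         - (hyp 0 k 4 x - 2 * k\<^sup>2 * hyp 0 k 2 x + k ^ 4 * hyp 0 k 0 x) / sinh k)"
    unfolding extremal_def a_def[symmetric] b_def[symmetric]
    by (simp add: algebra_simps add_divide_distrib diff_divide_distrib)
  also have "\<dots> = 0" unfolding h g by simp
  finally show ?thesis .
qed

lemma extremal_boundary:
  assumes k: "k > 0"
  shows "extremal k A B 0 1 = 0" "extremal k A B 0 (-1) = 0"
    and "extremal k A B 1 1 = A + B" "extremal k A B 1 (-1) = B - A"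
    and "extremal k A B 2 1 = A / even_compliance k + B / odd_compliance k"
    and "extremal k A B 2 (-1) = A / even_compliance k - B / odd_compliance k"
proof -
  define s c where "s = sinh k" and "c = cosh k"
  have pos: "s > 0" "c > 0" using k by (auto simp: s_def c_def)
  have sc: "s * c + k \<noteq> 0" "s * c - k \<noteq> 0"
    using less_sinh_cosh[OF k] k unfolding s_def c_def by auto
  have cs: "c\<^sup>2 - s\<^sup>2 = 1" unfolding s_def c_def by (simp add: hyperbolic_pythagoras)
  define a where "a = s * c / (s * c + k)"
  define b where "b = s * c / (s * c - k)"
  have e: "extremal k A B n x =
      A * a * (xhyp 0 k n x / s - hyp 1 k n x / c) + B * b * (xhyp 1 k n x / c - hyp 0 k n x / s)" for n x
    by (simp add: extremal_def a_def b_def s_def c_def)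
  show "extremal k A B 0 1 = 0" "extremal k A B 0 (-1) = 0"
    using pos unfolding e by (simp_all add: xhyp_def hyp_def flip: s_def c_def)
  have a1: "a * ((s + k * c) / s - k * s / c) = 1"
  proof -
    have "(s + k * c) / s - k * s / c = (s * c + k * (c\<^sup>2 - s\<^sup>2)) / (s * c)"
      using pos by (simp add: field_simps power2_eq_square)
    then show ?thesis using pos sc by (simp add: cs a_def)
  qed
  have b1: "b * ((c + k * s) / c - k * c / s) = 1"
  proof -
    have "(c + k * s) / c - k * c / s = (s * c - k * (c\<^sup>2 - s\<^sup>2)) / (s * c)"
      using pos by (simp add: field_simps power2_eq_square)
    then show ?thesis using pos sc by (simp add: cs b_def)
  qed
  show "extremal k A B 1 1 = A + B"
  proof -
    have "extremal k A B 1 1 = A * (a * ((s + k * c) / s - k * s / c)) + B * (b * ((c + k * s) / c - k * c / s))"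
      unfolding e by (simp add: xhyp_def hyp_def algebra_simps flip: s_def c_def)
    then show ?thesis unfolding a1 b1 by simp
  qed
  show "extremal k A B 1 (-1) = B - A"
  proof -
    have "extremal k A B 1 (-1) = - A * (a * ((s + k * c) / s - k * s / c)) + B * (b * ((c + k * s) / c - k * c / s))"
      unfolding e using pos by (simp add: xhyp_def hyp_def field_simps flip: s_def c_def)
    then show ?thesis unfolding a1 b1 by simp
  qed
  have a2: "a * (2 * k * c / s) = 1 / even_compliance k"
    using pos sc k by (simp add: a_def even_compliance_def power2_eq_square flip: s_def c_def)
  have b2: "b * (2 * k * s / c) = 1 / odd_compliance k"
    using pos sc k by (simp add: b_def odd_compliance_def power2_eq_square flip: s_def c_def)
  show "extremal k A B 2 1 = A / even_compliance k + B / odd_compliance k"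
  proof -
    have "extremal k A B 2 1 = A * (a * (2 * k * c / s)) + B * (b * (2 * k * s / c))"
      unfolding e using pos by (simp add: xhyp_def hyp_def field_simps flip: s_def c_def)
    then show ?thesis unfolding a2 b2 by simp
  qed
  show "extremal k A B 2 (-1) = A / even_compliance k - B / odd_compliance k"
  proof -
    have "extremal k A B 2 (-1) = A * (a * (2 * k * c / s)) - B * (b * (2 * k * s / c))"
      unfolding e using pos by (simp add: xhyp_def hyp_def field_simps flip: s_def c_def)
    then show ?thesis unfolding a2 b2 by simp
  qed
qed

text \<open>The least energy for given boundary slopes.\<close>

definition boundary_energy :: "real \<Rightarrow> real \<Rightarrow> real \<Rightarrow> real" where
  "boundary_energy k A B = 2 * A\<^sup>2 / even_compliance k + 2 * B\<^sup>2 / odd_compliance k"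

lemma extremal_sobolev_zero: "k > 0 \<Longrightarrow> extremal k A B 0 \<in> sobolev_zero 2"
  unfolding sobolev_zero_def using extremal.in_sobolev extremal.cont_rep_0 extremal_boundary(1,2)
  by simp

lemma extremal_bdry_deriv:
  assumes "k > 0"
  shows "bdry_deriv 1 (extremal k A B 0) 1 = A + B" "bdry_deriv 1 (extremal k A B 0) (-1) = B - A"
  using assms extremal.bdry_deriv_eq[of 1 2 1 k A B] extremal.bdry_deriv_eq[of 1 2 "-1" k A B]
    extremal_boundary by auto

lemma bending_form_extremal:
  assumes k: "k > 0" and \<phi>: "\<phi> \<in> sobolev_zero 2"
    and "bdry_deriv 1 \<phi> 1 = A + B" "bdry_deriv 1 \<phi> (-1) = B - A"
  shows "(\<integral>x. weak_deriv 2 \<phi> x * extremal k A B 2 x + 2 * k\<^sup>2 * (weak_deriv 1 \<phi> x * extremal k A B 1 x)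
            + k ^ 4 * (\<phi> x * extremal k A B 0 x) \<partial>I_meas) = boundary_energy k A B"
  unfolding smooth_chain.bending_form[OF extremal.smooth_chain_axioms \<phi> order_refl] extremal_ode
    boundary_energy_def extremal_boundary[OF k] assms(3,4)
  by (simp add: algebra_simps power2_eq_square add_divide_distrib diff_divide_distrib)

lemma bending_energy_extremal:
  assumes k: "k > 0" shows "bending_energy k (extremal k A B 0) = boundary_energy k A B"
    "(\<integral>x. (extremal k A B 2 x)\<^sup>2 + 2 * k\<^sup>2 * (extremal k A B 1 x)\<^sup>2
      + k ^ 4 * (extremal k A B 0 x)\<^sup>2 \<partial>I_meas) = boundary_energy k A B"
proof -
  let ?v = "extremal k A B"
  have s: "?v 0 \<in> sobolev 2" by (rule extremal.in_sobolev)
  have m [measurable]: "weak_deriv 1 (?v 0) \<in> borel_measurable I_meas"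
    "weak_deriv 2 (?v 0) \<in> borel_measurable I_meas" "?v n \<in> borel_measurable I_meas" for n
    using sobolev_L2(2)[OF s] measurable_I_continuous[OF extremal.cont] by (auto simp: L2_I_def)
  have 1: "AE x in I_meas. weak_deriv 1 (?v 0) x = ?v 1 x"
    by (rule extremal.weak_deriv_eq[of 1 2]) simp
  have 2: "AE x in I_meas. weak_deriv 2 (?v 0) x = ?v 2 x"
    by (rule extremal.weak_deriv_eq[of 2 2]) simp
  have "bending_energy k (?v 0) =
      (\<integral>x. weak_deriv 2 (?v 0) x * ?v 2 x + 2 * k\<^sup>2 * (weak_deriv 1 (?v 0) x * ?v 1 x)
            + k ^ 4 * (?v 0 x * ?v 0 x) \<partial>I_meas)"
    unfolding bending_energy_def
    by (rule integral_cong_AE, measurable)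
      (use 1 2 in eventually_elim, simp add: power2_eq_square)
  then show *: "bending_energy k (?v 0) = boundary_energy k A B"
    using bending_form_extremal[OF k extremal_sobolev_zero[OF k] extremal_bdry_deriv[OF k]] by simp
  have "(\<integral>x. (?v 2 x)\<^sup>2 + 2 * k\<^sup>2 * (?v 1 x)\<^sup>2 + k ^ 4 * (?v 0 x)\<^sup>2 \<partial>I_meas) = bending_energy k (?v 0)"
    unfolding bending_energy_def
    by (rule integral_cong_AE, measurable)
      (use 1 2 in eventually_elim, simp)
  with * show "(\<integral>x. (?v 2 x)\<^sup>2 + 2 * k\<^sup>2 * (?v 1 x)\<^sup>2 + k ^ 4 * (?v 0 x)\<^sup>2 \<partial>I_meas)
      = boundary_energy k A B" by simp
qed

text \<open>Expand the energy of \<open>\<phi> - v\<close>, where \<open>v\<close> is the extremal with the slopes of \<open>\<phi>\<close>: both the mixed term and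
  the energy of \<open>v\<close> equal the boundary energy.\<close>

lemma boundary_energy_le_bending_energy:
  assumes k: "k > 0" and \<phi>: "\<phi> \<in> sobolev_zero 2"
    and bd: "bdry_deriv 1 \<phi> 1 = A + B" "bdry_deriv 1 \<phi> (-1) = B - A"
  shows "boundary_energy k A B \<le> bending_energy k \<phi>"
proof -
  let ?v = "extremal k A B" and ?w1 = "weak_deriv 1 \<phi>" and ?w2 = "weak_deriv 2 \<phi>"
  have s: "\<phi> \<in> sobolev 2" using \<phi> by (simp add: sobolev_zero_def)
  have L2: "\<phi> \<in> L2_I" "?w1 \<in> L2_I" "?w2 \<in> L2_I"
    using sobolev_L2[OF s] by auto
  have int [simp]: "integrable I_meas (\<lambda>x. (\<phi> x)\<^sup>2)" "integrable I_meas (\<lambda>x. (?w1 x)\<^sup>2)"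
    "integrable I_meas (\<lambda>x. (?w2 x)\<^sup>2)" "integrable I_meas (\<lambda>x. \<phi> x * ?v n x)"
    "integrable I_meas (\<lambda>x. ?w1 x * ?v n x)" "integrable I_meas (\<lambda>x. ?w2 x * ?v n x)"
    "integrable I_meas (\<lambda>x. (?v n x)\<^sup>2)" for n
    using L2 extremal.L2_mult[of _ k A B n]
    by (auto simp: L2_I_def intro!: integrable_I_continuous continuous_intros extremal.cont)
  have "0 \<le> (\<integral>x. (?w2 x - ?v 2 x)\<^sup>2 + 2 * k\<^sup>2 * (?w1 x - ?v 1 x)\<^sup>2 + k ^ 4 * (\<phi> x - ?v 0 x)\<^sup>2 \<partial>I_meas)"
    by (rule Bochner_Integration.integral_nonneg) auto
  also have "\<dots> = (\<integral>x. ((?w2 x)\<^sup>2 + 2 * k\<^sup>2 * (?w1 x)\<^sup>2 + k ^ 4 * (\<phi> x)\<^sup>2)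
      - 2 * (?w2 x * ?v 2 x + 2 * k\<^sup>2 * (?w1 x * ?v 1 x) + k ^ 4 * (\<phi> x * ?v 0 x))
      + ((?v 2 x)\<^sup>2 + 2 * k\<^sup>2 * (?v 1 x)\<^sup>2 + k ^ 4 * (?v 0 x)\<^sup>2) \<partial>I_meas)"
    by (intro Bochner_Integration.integral_cong) (auto simp: power2_diff algebra_simps)
  also have "\<dots> = bending_energy k \<phi>
      - 2 * (\<integral>x. ?w2 x * ?v 2 x + 2 * k\<^sup>2 * (?w1 x * ?v 1 x) + k ^ 4 * (\<phi> x * ?v 0 x) \<partial>I_meas)
      + (\<integral>x. (?v 2 x)\<^sup>2 + 2 * k\<^sup>2 * (?v 1 x)\<^sup>2 + k ^ 4 * (?v 0 x)\<^sup>2 \<partial>I_meas)"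
    unfolding bending_energy_def
    by (simp del: One_nat_def distrib_left_numeral)
  also have "\<dots> = bending_energy k \<phi> - boundary_energy k A B"
    by (simp only: bending_form_extremal[OF k \<phi> bd] bending_energy_extremal(2)[OF k])
  finally show ?thesis by simp
qed

text \<open>The maximum that defines the critical viscosity is \<open>max 0 R\<close>, where \<open>R\<close> is the maximum of the quotient of two
  quadratic forms on the plane of boundary slopes. Proving that it is attained is essential: only then does the
  defining \<open>GREATEST\<close> carry information. Since \<open>\<mu> > 0\<close>, the bound \<open>\<mu> < max 0 R\<close> forces \<open>\<mu> < R\<close>.\<close>

lemma critical_viscosity_direction:
  assumes k: "k > 0" and \<mu>: "0 < \<mu>" "\<mu> < critical_viscosity k (\<xi>m, \<xi>p)"
  obtains A B where
    "\<mu> * boundary_energy k A B < \<xi>p * (A + B)\<^sup>2 + \<xi>m * (B - A)\<^sup>2"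
proof -
  define N where "N A B = \<xi>p * (A + B)\<^sup>2 + \<xi>m * (B - A)\<^sup>2" for A B
  note c = compliance_pos[OF k]
  have pos: "boundary_energy k A B > 0" if "(A, B) \<noteq> 0" for A B
    using that c by (cases "A = 0") (auto simp: boundary_energy_def zero_prod_def intro!: add_pos_nonneg)
  have rq: "rayleigh_quotient k (\<xi>m, \<xi>p) \<phi> = N ((b - a) / 2) ((a + b) / 2) / bending_energy k \<phi>"
    if "a = bdry_deriv 1 \<phi> (-1)" "b = bdry_deriv 1 \<phi> 1" for \<phi> a b
    unfolding that rayleigh_quotient_def N_def bending_energy_def by (simp add: field_simps)
  define q where "q = (\<lambda>(A, B). N A B / boundary_energy k A B)"
  have "continuous_on (sphere (0::real \<times> real) 1) q"
    unfolding q_def case_prod_beta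
  proof (rule continuous_on_divide)
    show "continuous_on (sphere (0::real \<times> real) 1) (\<lambda>p. N (fst p) (snd p))"
      unfolding N_def by (intro continuous_intros)
    show "continuous_on (sphere (0::real \<times> real) 1) (\<lambda>p. boundary_energy k (fst p) (snd p))"
      unfolding boundary_energy_def by (intro continuous_intros) (use c in auto)
    show "\<forall>p\<in>sphere (0::real \<times> real) 1. boundary_energy k (fst p) (snd p) \<noteq> 0"
    proof
      fix p :: "real \<times> real" assume "p \<in> sphere 0 1"
      then have "(fst p, snd p) \<noteq> 0" by auto
      then show "boundary_energy k (fst p) (snd p) \<noteq> 0" using pos by fastforce
    qed
  qed
  then obtain z where z: "z \<in> sphere 0 1" "\<And>y. y \<in> sphere 0 1 \<Longrightarrow> q y \<le> q z"
    using continuous_attains_sup[of "sphere (0::real \<times> real) 1" q] by (auto simp: compact_sphere)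
  obtain A0 B0 where z0: "z = (A0, B0)" by (cases z)
  have zne: "(A0, B0) \<noteq> 0" using z(1) unfolding z0 by auto
  define R where "R = N A0 B0 / boundary_energy k A0 B0"
  have R: "N A B / boundary_energy k A B \<le> R" if "(A, B) \<noteq> 0" for A B
  proof -
    define r where "r = norm (A, B)"
    have r: "r > 0" using that by (simp add: r_def)
    have "(A / r, B / r) = (1 / r) *\<^sub>R (A, B)" by simp
    then have "(A / r, B / r) \<in> sphere 0 1"
      using r by (simp add: r_def del: scaleR_Pair)
    then have "q (A / r, B / r) \<le> q z" by (rule z(2))
    moreover have "N (A / r) (B / r) = N A B / r\<^sup>2" "boundary_energy k (A / r) (B / r) = boundary_energy k A B / r\<^sup>2"
      using r by (simp_all add: N_def boundary_energy_def field_simps power2_eq_square)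
    ultimately show ?thesis using r by (simp add: q_def z0 R_def)
  qed
  have upper: "rayleigh_quotient k (\<xi>m, \<xi>p) \<phi> \<le> max 0 R" if \<phi>: "\<phi> \<in> sobolev_zero 2" for \<phi>
  proof -
    define a where "a = bdry_deriv 1 \<phi> (-1)"
    define b where "b = bdry_deriv 1 \<phi> 1"
    define A where "A = (b - a) / 2"
    define B where "B = (a + b) / 2"
    have ab: "bdry_deriv 1 \<phi> 1 = A + B" "bdry_deriv 1 \<phi> (-1) = B - A"
      by (auto simp: A_def B_def a_def b_def field_simps)
    have le: "boundary_energy k A B \<le> bending_energy k \<phi>"
      by (rule boundary_energy_le_bending_energy[OF k \<phi> ab])
    have eq: "rayleigh_quotient k (\<xi>m, \<xi>p) \<phi> = N A B / bending_energy k \<phi>"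
      unfolding A_def B_def by (rule rq[OF a_def b_def])
    have nonneg: "boundary_energy k A B \<ge> 0" using c by (simp add: boundary_energy_def)
    show ?thesis
    proof (cases "N A B > 0")
      case True
      then have ne: "(A, B) \<noteq> 0" by (auto simp: N_def zero_prod_def)
      have "N A B / bending_energy k \<phi> \<le> N A B / boundary_energy k A B"
        using True le pos[OF ne] by (intro divide_left_mono) auto
      with R[OF ne] show ?thesis unfolding eq by simp
    next
      case False
      then have "N A B / bending_energy k \<phi> \<le> 0"
        using le nonneg by (intro divide_nonpos_nonneg) auto
      then show ?thesis unfolding eq by simp
    qed
  qed
  have attained: "\<exists>\<phi>. \<phi> \<in> sobolev_zero 2 \<and> nonzero_I \<phi> \<and> rayleigh_quotient k (\<xi>m, \<xi>p) \<phi> = max 0 R"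
  proof (cases "R > 0")
    case True
    let ?\<phi> = "extremal k A0 B0 0"
    note bd = extremal_bdry_deriv[OF k, of A0 B0]
    have "nonzero_I ?\<phi>"
    proof (cases "A0 + B0 = 0")
      case True
      then have "B0 - A0 \<noteq> 0" using zne by (auto simp: zero_prod_def)
      then show ?thesis
        using nonzero_I_if_bdry_deriv[OF extremal.in_sobolev, of 1 2 "-1"] bd(2) by auto
    next
      case False
      then show ?thesis
        using nonzero_I_if_bdry_deriv[OF extremal.in_sobolev, of 1 2 1] bd(1) by auto
    qed
    moreover have "rayleigh_quotient k (\<xi>m, \<xi>p) ?\<phi> = R"
      using rq[OF bd(2)[symmetric] bd(1)[symmetric]] bending_energy_extremal(1)[OF k]
      by (simp add: R_def)
    ultimately show ?thesis
      using True extremal_sobolev_zero[OF k] by (intro exI[of _ ?\<phi>]) auto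
  next
    case False
    \<comment> \<open>If no direction is positive, the maximum 0 is attained by any function with vanishing slopes at the
      boundary; \<open>(1 - x\<^sup>2)\<^sup>2\<close> is one.\<close>
    define d :: "nat \<Rightarrow> real \<Rightarrow> real" where
      "d n x = (if n = 0 then (1 - x\<^sup>2)\<^sup>2 else if n = 1 then 4 * x ^ 3 - 4 * x else 12 * x\<^sup>2 - 4)" for n x
    have der: "(d n has_real_derivative d (Suc n) x) (at x within {-1..1})" if "n < 2" for n x
      using that by (cases n) (auto simp: d_def[abs_def] power2_eq_square power3_eq_cube algebra_simps
          intro!: derivative_eq_intros)
    have cont: "continuous_on {-1..1} (d n)" for n
      unfolding d_def[abs_def] by (cases "n = 0"; cases "n = 1") (auto intro!: continuous_intros)
    have z: "d 0 \<in> sobolev_zero 2"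
      using classical_sobolev[of 2 d, OF der cont] cont_rep_classical[OF cont[of 0]]
      by (auto simp: sobolev_zero_def d_def)
    have "nonzero_I (d 0)"
      using continuous_AE_zero[OF cont[of 0], of 0] by (auto simp: nonzero_I_def d_def)
    moreover have "bdry_deriv 1 (d 0) 1 = 0" "bdry_deriv 1 (d 0) (-1) = 0"
      using classical_bdry_deriv[of 2 d, OF der cont, of 1] by (auto simp: d_def)
    then have "rayleigh_quotient k (\<xi>m, \<xi>p) (d 0) = 0"
      by (simp add: rayleigh_quotient_def)
    ultimately show ?thesis using z False by (intro exI[of _ "d 0"]) auto
  qed
  have "critical_viscosity k (\<xi>m, \<xi>p) = max 0 R"
    unfolding critical_viscosity_def
    by (rule Greatest_equality) (use attained upper in force)+
  then have "\<mu> < R" using \<mu> by simp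
  then have "\<mu> * boundary_energy k A0 B0 < N A0 B0"
    using pos[OF zne] by (simp add: R_def pos_less_divide_eq)
  then show ?thesis using that unfolding N_def by blast
qed

section \<open>Green's identity for the boundary value problem\<close>

lemma (in smooth_chain) parts_4:
  assumes \<phi>: "\<phi> \<in> sobolev_zero s" "4 \<le> s" and v: "v 0 1 = 0" "v 0 (-1) = 0"
  shows "(\<integral>x. weak_deriv 4 \<phi> x * v 0 x \<partial>I_meas) =
      (bdry_deriv 1 \<phi> 1 * v 2 1 - bdry_deriv 2 \<phi> 1 * v 1 1)
    - (bdry_deriv 1 \<phi> (-1) * v 2 (-1) - bdry_deriv 2 \<phi> (-1) * v 1 (-1))
    + (\<integral>x. \<phi> x * v 4 x \<partial>I_meas)"
proof -
  have s: "\<phi> \<in> sobolev s" using \<phi>(1) by (auto simp: sobolev_zero_def)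
  have 3: "has_weak_deriv 1 (weak_deriv 2 \<phi>) (weak_deriv 3 \<phi>)"
    using sobolev_weak_deriv_Suc[OF s, of 2] \<phi>(2) by simp
  have 4: "has_weak_deriv 1 (weak_deriv 3 \<phi>) (weak_deriv 4 \<phi>)"
    using sobolev_weak_deriv_Suc[OF s, of 3] \<phi>(2) by simp
  have "(\<integral>x. weak_deriv 4 \<phi> x * v 0 x \<partial>I_meas) = - (\<integral>x. weak_deriv 3 \<phi> x * v 1 x \<partial>I_meas)"
    using parts[OF 4, of 0] v by simp
  also have "(\<integral>x. weak_deriv 3 \<phi> x * v 1 x \<partial>I_meas) =
      bdry_deriv 2 \<phi> 1 * v 1 1 - bdry_deriv 2 \<phi> (-1) * v 1 (-1) - (\<integral>x. weak_deriv 2 \<phi> x * v 2 x \<partial>I_meas)"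
    using parts[OF 3, of 1] by (simp only: Suc_1)
  also have "(\<integral>x. weak_deriv 2 \<phi> x * v 2 x \<partial>I_meas) =
      bdry_deriv 1 \<phi> 1 * v 2 1 - bdry_deriv 1 \<phi> (-1) * v 2 (-1) + (\<integral>x. \<phi> x * v 4 x \<partial>I_meas)"
    using parts_2(2)[OF \<phi>(1), of 2] \<phi>(2) by simp
  finally show ?thesis by simp
qed

lemma solves_bvpD:
  assumes "solves_bvp k \<mu> (\<xi>m, \<xi>p) l \<phi>"
  shows "AE x in I_meas. l * (k\<^sup>2 * \<phi> x - weak_deriv 2 \<phi> x)
          + \<mu> * (weak_deriv 4 \<phi> x - 2 * k\<^sup>2 * weak_deriv 2 \<phi> x + k ^ 4 * \<phi> x) = 0"
    and "cont_rep \<phi> 1 = 0" "cont_rep \<phi> (-1) = 0"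
    and "\<mu> * bdry_deriv 2 \<phi> 1 = \<xi>p * bdry_deriv 1 \<phi> 1"
    and "\<mu> * bdry_deriv 2 \<phi> (-1) = - \<xi>m * bdry_deriv 1 \<phi> (-1)"
  using assms by (auto simp: solves_bvp_def)

text \<open>The equation integrated against a continuous function, sorted by derivatives of \<open>\<phi>\<close>.\<close>

lemma tested_equation:
  assumes \<phi>: "\<phi> \<in> sobolev 4" and bvp: "solves_bvp k \<mu> (\<xi>m, \<xi>p) l \<phi>"
    and v: "continuous_on {-1..1} v"
  shows "(l * k\<^sup>2 + \<mu> * k ^ 4) * (\<integral>x. \<phi> x * v x \<partial>I_meas)
     - (l + 2 * \<mu> * k\<^sup>2) * (\<integral>x. weak_deriv 2 \<phi> x * v x \<partial>I_meas)
     + \<mu> * (\<integral>x. weak_deriv 4 \<phi> x * v x \<partial>I_meas) = 0"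
proof -
  have int [simp]: "integrable I_meas (\<lambda>x. \<phi> x * v x)" "integrable I_meas (\<lambda>x. weak_deriv 2 \<phi> x * v x)"
    "integrable I_meas (\<lambda>x. weak_deriv 4 \<phi> x * v x)"
    using sobolev_L2[OF \<phi>] by (auto intro: L2_I_mult_continuous v)
  have "(\<integral>x. (l * k\<^sup>2 + \<mu> * k ^ 4) * (\<phi> x * v x) - (l + 2 * \<mu> * k\<^sup>2) * (weak_deriv 2 \<phi> x * v x)
     + \<mu> * (weak_deriv 4 \<phi> x * v x) \<partial>I_meas) = 0"
  proof (rule integral_eq_zero_AE)
    show "AE x in I_meas. (l * k\<^sup>2 + \<mu> * k ^ 4) * (\<phi> x * v x)
        - (l + 2 * \<mu> * k\<^sup>2) * (weak_deriv 2 \<phi> x * v x) + \<mu> * (weak_deriv 4 \<phi> x * v x) = 0"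
      using solves_bvpD(1)[OF bvp]
    proof eventually_elim
      case (elim x)
      then have "(l * (k\<^sup>2 * \<phi> x - weak_deriv 2 \<phi> x)
          + \<mu> * (weak_deriv 4 \<phi> x - 2 * k\<^sup>2 * weak_deriv 2 \<phi> x + k ^ 4 * \<phi> x)) * v x = 0"
        by simp
      then show ?case by (simp add: algebra_simps)
    qed
  qed
  then show ?thesis by simp
qed

text \<open>The operator is symmetric, so all interior terms cancel when a solution \<open>\<phi>\<close> is tested against a classical
  solution \<open>v\<close>. As both vanish at the end points, only products of first and second derivatives remain, and the slip
  conditions express the second derivative of \<open>\<phi>\<close> by the first.\<close>

lemma (in smooth_chain) green_identity:
  assumes \<phi>: "\<phi> \<in> sobolev 4" and bvp: "solves_bvp k \<mu> (\<xi>m, \<xi>p) l \<phi>"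
    and v: "v 0 1 = 0" "v 0 (-1) = 0"
    and ode: "\<And>x. l * (k\<^sup>2 * v 0 x - v 2 x) + \<mu> * (v 4 x - 2 * k\<^sup>2 * v 2 x + k ^ 4 * v 0 x) = 0"
  shows "\<mu> * bdry_deriv 1 \<phi> 1 * v 2 1 - \<xi>p * bdry_deriv 1 \<phi> 1 * v 1 1 =
    \<mu> * bdry_deriv 1 \<phi> (-1) * v 2 (-1) + \<xi>m * bdry_deriv 1 \<phi> (-1) * v 1 (-1)"
proof -
  have z: "\<phi> \<in> sobolev_zero 4"
    using \<phi> solves_bvpD[OF bvp] by (auto simp: sobolev_zero_def)
  have int [simp]: "integrable I_meas (\<lambda>x. \<phi> x * v n x)" for n
    using sobolev_L2[OF \<phi>] by (auto intro: L2_mult)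
  have "(\<integral>x. (l * k\<^sup>2 + \<mu> * k ^ 4) * (\<phi> x * v 0 x) - (l + 2 * \<mu> * k\<^sup>2) * (\<phi> x * v 2 x)
     + \<mu> * (\<phi> x * v 4 x) \<partial>I_meas) = (\<integral>x. 0 \<partial>I_meas)"
  proof (rule Bochner_Integration.integral_cong[OF refl])
    fix x
    have "\<phi> x * (l * (k\<^sup>2 * v 0 x - v 2 x) + \<mu> * (v 4 x - 2 * k\<^sup>2 * v 2 x + k ^ 4 * v 0 x)) = 0"
      unfolding ode by simp
    then show "(l * k\<^sup>2 + \<mu> * k ^ 4) * (\<phi> x * v 0 x) - (l + 2 * \<mu> * k\<^sup>2) * (\<phi> x * v 2 x)
     + \<mu> * (\<phi> x * v 4 x) = 0" by (simp add: algebra_simps)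
  qed
  then have eq: "(l * k\<^sup>2 + \<mu> * k ^ 4) * (\<integral>x. \<phi> x * v 0 x \<partial>I_meas)
     - (l + 2 * \<mu> * k\<^sup>2) * (\<integral>x. \<phi> x * v 2 x \<partial>I_meas) + \<mu> * (\<integral>x. \<phi> x * v 4 x \<partial>I_meas) = 0"
    by simp
  have w2: "(\<integral>x. weak_deriv 2 \<phi> x * v 0 x \<partial>I_meas) = (\<integral>x. \<phi> x * v 2 x \<partial>I_meas)"
    using parts_2(2)[OF z, of 0] v by (simp add: numeral_2_eq_2)
  define W where "W = (bdry_deriv 1 \<phi> 1 * v 2 1 - bdry_deriv 2 \<phi> 1 * v 1 1)
    - (bdry_deriv 1 \<phi> (-1) * v 2 (-1) - bdry_deriv 2 \<phi> (-1) * v 1 (-1))"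
  have w4: "(\<integral>x. weak_deriv 4 \<phi> x * v 0 x \<partial>I_meas) = W + (\<integral>x. \<phi> x * v 4 x \<partial>I_meas)"
    unfolding W_def by (rule parts_4[OF z order_refl v])
  have "\<mu> * W = 0"
    using tested_equation[OF \<phi> bvp cont[of _ 0]] eq unfolding w2 w4 distrib_left by linarith
  then have "\<mu> * bdry_deriv 1 \<phi> 1 * v 2 1 - (\<mu> * bdry_deriv 2 \<phi> 1) * v 1 1 =
      \<mu> * bdry_deriv 1 \<phi> (-1) * v 2 (-1) - (\<mu> * bdry_deriv 2 \<phi> (-1)) * v 1 (-1)"
    unfolding W_def by (simp add: algebra_simps)
  then show ?thesis
    unfolding solves_bvpD(4,5)[OF bvp] by simp
qed

text \<open>Testing the equation with \<open>\<phi>\<close> itself leaves a sum of squares with positive coefficients and no boundary terms,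
  so all of them vanish.\<close>

lemma clamped_solution_trivial:
  assumes \<phi>: "\<phi> \<in> sobolev 4" and bvp: "solves_bvp k \<mu> (\<xi>m, \<xi>p) l \<phi>"
    and pos: "k \<noteq> 0" "\<mu> > 0" "l > 0"
    and clamped: "bdry_deriv 1 \<phi> 1 = 0" "bdry_deriv 1 \<phi> (-1) = 0"
  shows "AE x in I_meas. \<phi> x = 0"
proof -
  note s = sobolev_weak_deriv_Suc[OF \<phi>]
  have d: "has_weak_deriv 1 \<phi> (weak_deriv 1 \<phi>)" "has_weak_deriv 1 (weak_deriv 1 \<phi>) (weak_deriv 2 \<phi>)"
    "has_weak_deriv 1 (weak_deriv 2 \<phi>) (weak_deriv 3 \<phi>)" "has_weak_deriv 1 (weak_deriv 3 \<phi>) (weak_deriv 4 \<phi>)"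
    using sobolev_weak_deriv_1[OF \<phi>] s[of 1] s[of 2] s[of 3] by (auto simp: Suc_1 simp del: One_nat_def)
  note z = solves_bvpD(2,3)[OF bvp]
  note p0 = weak_integration_by_parts[OF _ cont_rep_has_derivative[OF d(1,2)] cont_rep_continuous[OF d(2)]]
  note p1 = weak_integration_by_parts[OF _ cont_rep_has_derivative[OF d(2,3)] cont_rep_continuous[OF d(3)]]
  have sq: "(\<integral>x. f x * cont_rep f x \<partial>I_meas) = (\<integral>x. (f x)\<^sup>2 \<partial>I_meas)" if f: "has_weak_deriv 1 f g" for f g
  proof (rule integral_cong_AE)
    show "(\<lambda>x. f x * cont_rep f x) \<in> borel_measurable I_meas" "(\<lambda>x. (f x)\<^sup>2) \<in> borel_measurable I_meas"
      using has_weak_derivD(1)[OF f] measurable_I_continuous[OF cont_rep_continuous[OF f]]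
      by (auto simp: L2_I_def)
    show "AE x in I_meas. f x * cont_rep f x = (f x)\<^sup>2"
      using cont_rep_AE[OF f] by eventually_elim (simp add: power2_eq_square)
  qed
  have "(\<integral>x. weak_deriv 2 \<phi> x * cont_rep \<phi> x \<partial>I_meas) = - (\<integral>x. (weak_deriv 1 \<phi> x)\<^sup>2 \<partial>I_meas)"
    using p0[OF d(2)] sq[OF d(2)] z by simp
  moreover have "(\<integral>x. weak_deriv 4 \<phi> x * cont_rep \<phi> x \<partial>I_meas) = (\<integral>x. (weak_deriv 2 \<phi> x)\<^sup>2 \<partial>I_meas)"
    using p0[OF d(4)] p1[OF d(3)] sq[OF d(3)] z clamped by simp
  ultimately have "(l * k\<^sup>2 + \<mu> * k ^ 4) * (\<integral>x. (\<phi> x)\<^sup>2 \<partial>I_meas)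
     + (l + 2 * \<mu> * k\<^sup>2) * (\<integral>x. (weak_deriv 1 \<phi> x)\<^sup>2 \<partial>I_meas)
     + \<mu> * (\<integral>x. (weak_deriv 2 \<phi> x)\<^sup>2 \<partial>I_meas) = 0"
    using tested_equation[OF \<phi> bvp cont_rep_continuous[OF d(1)]] sq[OF d(1)] by simp
  moreover have "0 \<le> (l + 2 * \<mu> * k\<^sup>2) * (\<integral>x. (weak_deriv 1 \<phi> x)\<^sup>2 \<partial>I_meas)"
    "0 \<le> \<mu> * (\<integral>x. (weak_deriv 2 \<phi> x)\<^sup>2 \<partial>I_meas)" "0 \<le> (\<integral>x. (\<phi> x)\<^sup>2 \<partial>I_meas)"
    using pos by (auto intro!: mult_nonneg_nonneg)
  moreover have "l * k\<^sup>2 + \<mu> * k ^ 4 > 0" using pos by (intro add_pos_pos) auto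
  ultimately have "(\<integral>x. (\<phi> x)\<^sup>2 \<partial>I_meas) = 0"
    by (smt (verit) mult_pos_pos)
  then show ?thesis
    using integral_nonneg_eq_0_iff_AE[of I_meas "\<lambda>x. (\<phi> x)\<^sup>2"] has_weak_derivD(1)[OF d(1)]
    by (simp add: L2_I_def)
qed

section \<open>Separated modes and the characteristic equation\<close>

text \<open>The slope at \<open>1\<close> of \<open>cosh (\<beta> x) / cosh \<beta> - cosh (k x) / cosh k\<close>, and of its odd counterpart.\<close>

definition even_slope :: "real \<Rightarrow> real \<Rightarrow> real" where
  "even_slope k \<beta> = \<beta> * sinh \<beta> / cosh \<beta> - k * sinh k / cosh k"

definition odd_slope :: "real \<Rightarrow> real \<Rightarrow> real" where
  "odd_slope k \<beta> = \<beta> * cosh \<beta> / sinh \<beta> - k * cosh k / sinh k"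

lemma has_derivative_even_slope:
  "(even_slope k has_real_derivative (sinh \<beta> * cosh \<beta> + \<beta>) / (cosh \<beta>)\<^sup>2) (at \<beta>)"
proof -
  have "(even_slope k has_real_derivative
      ((sinh \<beta> + \<beta> * cosh \<beta>) * cosh \<beta> - \<beta> * sinh \<beta> * sinh \<beta>) / (cosh \<beta> * cosh \<beta>)) (at \<beta>)"
    unfolding even_slope_def[abs_def] by (auto intro!: derivative_eq_intros)
  also have "(sinh \<beta> + \<beta> * cosh \<beta>) * cosh \<beta> - \<beta> * sinh \<beta> * sinh \<beta>
      = sinh \<beta> * cosh \<beta> + \<beta> * ((cosh \<beta>)\<^sup>2 - (sinh \<beta>)\<^sup>2)"
    by (simp add: algebra_simps power2_eq_square)
  finally show ?thesis unfolding hyperbolic_pythagoras by (simp add: power2_eq_square)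
qed

lemma has_derivative_odd_slope:
  assumes "\<beta> > 0"
  shows "(odd_slope k has_real_derivative (sinh \<beta> * cosh \<beta> - \<beta>) / (sinh \<beta>)\<^sup>2) (at \<beta>)"
proof -
  have "(odd_slope k has_real_derivative
      ((cosh \<beta> + \<beta> * sinh \<beta>) * sinh \<beta> - \<beta> * cosh \<beta> * cosh \<beta>) / (sinh \<beta> * sinh \<beta>)) (at \<beta>)"
    unfolding odd_slope_def[abs_def] using assms by (auto intro!: derivative_eq_intros)
  also have "(cosh \<beta> + \<beta> * sinh \<beta>) * sinh \<beta> - \<beta> * cosh \<beta> * cosh \<beta>
      = sinh \<beta> * cosh \<beta> - \<beta> * ((cosh \<beta>)\<^sup>2 - (sinh \<beta>)\<^sup>2)"
    by (simp add: algebra_simps power2_eq_square)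
  finally show ?thesis unfolding hyperbolic_pythagoras by (simp add: power2_eq_square)
qed

lemma slope_pos:
  assumes "0 < k" "k < \<beta>" shows "even_slope k \<beta> > 0" "odd_slope k \<beta> > 0"
proof -
  have "even_slope k k < even_slope k \<beta>"
  proof (rule DERIV_pos_imp_increasing[OF assms(2)])
    fix x assume "k \<le> x"
    then have "(sinh x * cosh x + x) / (cosh x)\<^sup>2 > 0"
      using assms(1) less_sinh_cosh[of x] by simp
    then show "\<exists>y. (even_slope k has_real_derivative y) (at x) \<and> 0 < y"
      using has_derivative_even_slope by blast
  qed
  then show "even_slope k \<beta> > 0" by (simp add: even_slope_def)
  have "odd_slope k k < odd_slope k \<beta>"
  proof (rule DERIV_pos_imp_increasing[OF assms(2)])
    fix x assume x: "k \<le> x"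
    then have "(sinh x * cosh x - x) / (sinh x)\<^sup>2 > 0"
      using assms(1) less_sinh_cosh[of x] by simp
    then show "\<exists>y. (odd_slope k has_real_derivative y) (at x) \<and> 0 < y"
      using has_derivative_odd_slope[of x k] x assms(1) by auto
  qed
  then show "odd_slope k \<beta> > 0" by (simp add: odd_slope_def)
qed

text \<open>The ratio \<open>v''(1) / v'(1)\<close> for the even, respectively odd, solution; the counterparts of \<open>1/P\<^sub>0\<close> and
  \<open>1/Q\<^sub>0\<close> at the parameter \<open>\<beta>\<close>.\<close>

definition even_stiffness :: "real \<Rightarrow> real \<Rightarrow> real" where
  "even_stiffness k \<beta> = (\<beta>\<^sup>2 - k\<^sup>2) / even_slope k \<beta>"

definition odd_stiffness :: "real \<Rightarrow> real \<Rightarrow> real" where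
  "odd_stiffness k \<beta> = (\<beta>\<^sup>2 - k\<^sup>2) / odd_slope k \<beta>"

text \<open>The general solution of \<open>(D\<^sup>2 - k\<^sup>2)(D\<^sup>2 - \<beta>\<^sup>2) v = 0\<close> that vanishes at \<open>\<plusminus>1\<close>, normalized like the extremals:
  \<open>v'(1) = A + B\<close> and \<open>v'(-1) = B - A\<close>.\<close>

definition mode :: "real \<Rightarrow> real \<Rightarrow> real \<Rightarrow> real \<Rightarrow> nat \<Rightarrow> real \<Rightarrow> real" where
  "mode k \<beta> A B n x =
     A / even_slope k \<beta> * (hyp 1 \<beta> n x / cosh \<beta> - hyp 1 k n x / cosh k)
   + B / odd_slope k \<beta> * (hyp 0 \<beta> n x / sinh \<beta> - hyp 0 k n x / sinh k)"

interpretation mode: smooth_chain "mode k \<beta> A B" for k \<beta> A B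
  by unfold_locales (unfold mode_def[abs_def],
    intro DERIV_add DERIV_cmult DERIV_diff DERIV_cdivide hyp_derivative)

lemma mode_ode:
  assumes "l = \<mu> * (\<beta>\<^sup>2 - k\<^sup>2)"
  shows "l * (k\<^sup>2 * mode k \<beta> A B 0 x - mode k \<beta> A B 2 x)
    + \<mu> * (mode k \<beta> A B 4 x - 2 * k\<^sup>2 * mode k \<beta> A B 2 x + k ^ 4 * mode k \<beta> A B 0 x) = 0"
proof -
  have hyp24: "hyp p c 2 x = c\<^sup>2 * hyp p c 0 x" "hyp p c 4 x = c ^ 4 * hyp p c 0 x" for p c
    by (auto simp: hyp_def)
  define a where "a = A / even_slope k \<beta>"
  define b where "b = B / odd_slope k \<beta>"
  define H where "H p c x = hyp p c 0 x / (if p = 1 then cosh c else sinh c)" for p :: nat and c x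
  have m: "mode k \<beta> A B 0 x = a * (H 1 \<beta> x - H 1 k x) + b * (H 0 \<beta> x - H 0 k x)"
    "mode k \<beta> A B 2 x = a * (\<beta>\<^sup>2 * H 1 \<beta> x - k\<^sup>2 * H 1 k x) + b * (\<beta>\<^sup>2 * H 0 \<beta> x - k\<^sup>2 * H 0 k x)"
    "mode k \<beta> A B 4 x = a * (\<beta> ^ 4 * H 1 \<beta> x - k ^ 4 * H 1 k x) + b * (\<beta> ^ 4 * H 0 \<beta> x - k ^ 4 * H 0 k x)"
    by (simp_all add: mode_def a_def b_def H_def hyp24)
  show ?thesis
    unfolding m assms by (simp add: algebra_simps power2_eq_square power4_eq_xxxx)
qed

lemma mode_boundary:
  assumes "0 < k" "k < \<beta>"
  shows "mode k \<beta> A B 0 1 = 0" "mode k \<beta> A B 0 (-1) = 0"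
    and "mode k \<beta> A B 1 1 = A + B" "mode k \<beta> A B 1 (-1) = B - A"
    and "mode k \<beta> A B 2 1 = A * even_stiffness k \<beta> + B * odd_stiffness k \<beta>"
    and "mode k \<beta> A B 2 (-1) = A * even_stiffness k \<beta> - B * odd_stiffness k \<beta>"
proof -
  have ne: "sinh k \<noteq> 0" "sinh \<beta> \<noteq> 0" "even_slope k \<beta> \<noteq> 0" "odd_slope k \<beta> \<noteq> 0"
    using assms slope_pos[OF assms] by auto
  show "mode k \<beta> A B 0 1 = 0" "mode k \<beta> A B 0 (-1) = 0"
    using ne by (simp_all add: mode_def hyp_def)
  show "mode k \<beta> A B 2 1 = A * even_stiffness k \<beta> + B * odd_stiffness k \<beta>"
    "mode k \<beta> A B 2 (-1) = A * even_stiffness k \<beta> - B * odd_stiffness k \<beta>"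
    using ne by (simp_all add: mode_def hyp_def even_stiffness_def odd_stiffness_def)
      (simp_all add: algebra_simps diff_divide_distrib)
  have 1: "hyp 1 \<beta> 1 1 / cosh \<beta> - hyp 1 k 1 1 / cosh k = even_slope k \<beta>"
    "hyp 1 \<beta> 1 (-1) / cosh \<beta> - hyp 1 k 1 (-1) / cosh k = - even_slope k \<beta>"
    "hyp 0 \<beta> 1 1 / sinh \<beta> - hyp 0 k 1 1 / sinh k = odd_slope k \<beta>"
    "hyp 0 \<beta> 1 (-1) / sinh \<beta> - hyp 0 k 1 (-1) / sinh k = odd_slope k \<beta>"
    by (simp_all add: hyp_def even_slope_def odd_slope_def)
  show "mode k \<beta> A B 1 1 = A + B" "mode k \<beta> A B 1 (-1) = B - A"
    unfolding mode_def 1 using ne by simp_all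
qed

text \<open>The determinant of \<open>[[2\<mu> u - S, -d], [-d, 2\<mu> w - S]]\<close> vanishes, where \<open>u\<close> and \<open>w\<close> are the two
  stiffnesses, \<open>S = \<xi>p + \<xi>m\<close> and \<open>d = \<xi>p - \<xi>m\<close>.\<close>

definition characteristic_root :: "real \<Rightarrow> real \<Rightarrow> real \<Rightarrow> real \<Rightarrow> real \<Rightarrow> bool" where
  "characteristic_root k \<mu> \<xi>m \<xi>p \<beta> \<longleftrightarrow>
     (2 * \<mu> * even_stiffness k \<beta> - (\<xi>p + \<xi>m)) * (2 * \<mu> * odd_stiffness k \<beta> - (\<xi>p + \<xi>m)) = (\<xi>p - \<xi>m)\<^sup>2"

lemma kernel_2x2:
  fixes a b d A B :: real
  assumes "a * A = d * B" "b * B = d * A" "A \<noteq> 0 \<or> B \<noteq> 0"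
  shows "a * b = d\<^sup>2"
proof -
  have "(a * b) * B = a * (b * B)" by simp
  also have "\<dots> = d * (a * A)" unfolding assms(2) by simp
  also have "\<dots> = d\<^sup>2 * B" unfolding assms(1) by (simp add: power2_eq_square)
  finally have B: "(a * b) * B = d\<^sup>2 * B" .
  have "(a * b) * A = b * (a * A)" by simp
  also have "\<dots> = d * (b * B)" unfolding assms(1) by simp
  also have "\<dots> = d\<^sup>2 * A" unfolding assms(2) by (simp add: power2_eq_square)
  finally have "(a * b) * A = d\<^sup>2 * A" .
  then show ?thesis using B assms(3) by auto
qed

lemma kernel_2x2_exists:
  fixes a b d :: real
  assumes "a * b = d\<^sup>2"
  obtains A B where "A \<noteq> 0 \<or> B \<noteq> 0" "a * A = d * B" "b * B = d * A"
proof (cases "a = 0 \<and> d = 0")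
  case True
  then show ?thesis using that[of 1 0] by simp
next
  case False
  then show ?thesis using that[of d a] assms by (auto simp: power2_eq_square mult_ac)
qed

text \<open>Green's identity with the even and the odd mode gives the two rows of the matrix equation for the boundary
  slopes of the solution; these slopes cannot both vanish.\<close>

lemma characteristic_value_imp_root:
  assumes k: "0 < k" "k < \<beta>" and \<mu>: "\<mu> > 0"
    and char: "characteristic_value k \<mu> (\<xi>m, \<xi>p) (\<mu> * (\<beta>\<^sup>2 - k\<^sup>2))"
  shows "characteristic_root k \<mu> \<xi>m \<xi>p \<beta>"
proof -
  define l where "l = \<mu> * (\<beta>\<^sup>2 - k\<^sup>2)"
  have "\<beta>\<^sup>2 > k\<^sup>2" using k by (intro power_strict_mono) auto
  then have l: "l > 0" using \<mu> by (simp add: l_def)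
  from char obtain \<phi> where \<phi>: "\<phi> \<in> sobolev 4" "nonzero_I \<phi>" and
    bvp: "solves_bvp k \<mu> (\<xi>m, \<xi>p) l \<phi>"
    unfolding characteristic_value_def l_def by blast
  define a where "a = bdry_deriv 1 \<phi> (-1)"
  define b where "b = bdry_deriv 1 \<phi> 1"
  have "b - a \<noteq> 0 \<or> b + a \<noteq> 0"
    using clamped_solution_trivial[OF \<phi>(1) bvp _ \<mu> l] \<phi>(2) k(1)
    unfolding nonzero_I_def a_def b_def by auto
  moreover have g: "\<mu> * b * mode k \<beta> A B 2 1 - \<xi>p * b * mode k \<beta> A B 1 1 =
      \<mu> * a * mode k \<beta> A B 2 (-1) + \<xi>m * a * mode k \<beta> A B 1 (-1)" for A B
    unfolding a_def b_def
    by (rule mode.green_identity[OF \<phi>(1) bvp mode_boundary(1,2)[OF k] mode_ode[OF l_def]])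
  have "(2 * \<mu> * even_stiffness k \<beta> - (\<xi>p + \<xi>m)) * (b - a) = (\<xi>p - \<xi>m) * (b + a)"
    using g[of 1 0] unfolding mode_boundary[OF k] by (simp add: algebra_simps)
  moreover have "(2 * \<mu> * odd_stiffness k \<beta> - (\<xi>p + \<xi>m)) * (b + a) = (\<xi>p - \<xi>m) * (b - a)"
    using g[of 0 1] unfolding mode_boundary[OF k] by (simp add: algebra_simps)
  ultimately show ?thesis
    unfolding characteristic_root_def by (intro kernel_2x2)
qed

text \<open>A kernel vector \<open>(A, B)\<close> makes the corresponding mode satisfy both slip conditions: their sum and difference
  are the two rows of the matrix equation.\<close>

lemma root_imp_characteristic_value:
  assumes k: "0 < k" "k < \<beta>" and root: "characteristic_root k \<mu> \<xi>m \<xi>p \<beta>"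
  shows "characteristic_value k \<mu> (\<xi>m, \<xi>p) (\<mu> * (\<beta>\<^sup>2 - k\<^sup>2))"
proof -
  from root obtain A B where AB: "A \<noteq> 0 \<or> B \<noteq> 0"
    "(2 * \<mu> * even_stiffness k \<beta> - (\<xi>p + \<xi>m)) * A = (\<xi>p - \<xi>m) * B"
    "(2 * \<mu> * odd_stiffness k \<beta> - (\<xi>p + \<xi>m)) * B = (\<xi>p - \<xi>m) * A"
    unfolding characteristic_root_def by (rule kernel_2x2_exists)
  let ?v = "mode k \<beta> A B"
  have s: "?v 0 \<in> sobolev 4" by (rule mode.in_sobolev)
  have bd: "bdry_deriv n (?v 0) x = ?v n x" if "n \<le> 4" "x \<in> {-1..1}" for n x
    using mode.bdry_deriv_eq that by blast
  have "A + B \<noteq> 0 \<or> B - A \<noteq> 0" using AB(1) by linarith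
  then have "bdry_deriv 1 (?v 0) 1 \<noteq> 0 \<or> bdry_deriv 1 (?v 0) (-1) \<noteq> 0"
    using bd[of 1 1] bd[of 1 "-1"] mode_boundary(3,4)[OF k, of A B] by simp
  then have "nonzero_I (?v 0)"
    using nonzero_I_if_bdry_deriv[OF s, of 1 1] nonzero_I_if_bdry_deriv[OF s, of 1 "-1"] by auto
  moreover have "solves_bvp k \<mu> (\<xi>m, \<xi>p) (\<mu> * (\<beta>\<^sup>2 - k\<^sup>2)) (?v 0)"
    unfolding solves_bvp_def prod.case
  proof (intro conjI)
    have "AE x in I_meas. weak_deriv 2 (?v 0) x = ?v 2 x" "AE x in I_meas. weak_deriv 4 (?v 0) x = ?v 4 x"
      using mode.weak_deriv_eq[of 2 4] mode.weak_deriv_eq[of 4 4] by auto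
    then show "AE x in I_meas. \<mu> * (\<beta>\<^sup>2 - k\<^sup>2) * (k\<^sup>2 * ?v 0 x - weak_deriv 2 (?v 0) x)
        + \<mu> * (weak_deriv 4 (?v 0) x - 2 * k\<^sup>2 * weak_deriv 2 (?v 0) x + k ^ 4 * ?v 0 x) = 0"
      using AE_space
    proof eventually_elim
      case (elim x)
      show ?case unfolding elim by (rule mode_ode[OF refl])
    qed
    show "cont_rep (?v 0) 1 = 0" "cont_rep (?v 0) (-1) = 0"
      using mode.cont_rep_0 mode_boundary(1,2)[OF k] by auto
    have "2 * (\<mu> * ?v 2 1) = 2 * (\<xi>p * ?v 1 1)"
      "2 * (\<mu> * ?v 2 (-1)) = 2 * (- \<xi>m * ?v 1 (-1))"
      unfolding mode_boundary[OF k] using AB(2,3) by (simp_all add: algebra_simps)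
    then show "\<mu> * bdry_deriv 2 (?v 0) 1 = \<xi>p * bdry_deriv 1 (?v 0) 1"
      "\<mu> * bdry_deriv 2 (?v 0) (-1) = - \<xi>m * bdry_deriv 1 (?v 0) (-1)"
      using bd[of 1 1] bd[of 1 "-1"] bd[of 2 1] bd[of 2 "-1"] by simp_all
  qed
  ultimately show ?thesis
    unfolding characteristic_value_def using s by blast
qed

lemma positive_characteristic_values:
  assumes k: "0 < k" and \<mu>: "\<mu> > 0"
  shows "{l. l > 0 \<and> characteristic_value k \<mu> (\<xi>m, \<xi>p) l} =
    (\<lambda>\<beta>. \<mu> * (\<beta>\<^sup>2 - k\<^sup>2)) ` {\<beta>. \<beta> > k \<and> characteristic_root k \<mu> \<xi>m \<xi>p \<beta>}"
proof (intro set_eqI iffI)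
  fix l assume l: "l \<in> {l. l > 0 \<and> characteristic_value k \<mu> (\<xi>m, \<xi>p) l}"
  define \<beta> where "\<beta> = sqrt (k\<^sup>2 + l / \<mu>)"
  have "l / \<mu> > 0" using l \<mu> by simp
  then have \<beta>: "\<beta> > k" "l = \<mu> * (\<beta>\<^sup>2 - k\<^sup>2)"
    using k \<mu> by (auto simp: \<beta>_def real_less_rsqrt)
  then show "l \<in> (\<lambda>\<beta>. \<mu> * (\<beta>\<^sup>2 - k\<^sup>2)) ` {\<beta>. \<beta> > k \<and> characteristic_root k \<mu> \<xi>m \<xi>p \<beta>}"
    using l characteristic_value_imp_root[OF k \<beta>(1) \<mu>] by auto
next
  fix l assume "l \<in> (\<lambda>\<beta>. \<mu> * (\<beta>\<^sup>2 - k\<^sup>2)) ` {\<beta>. \<beta> > k \<and> characteristic_root k \<mu> \<xi>m \<xi>p \<beta>}"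
  then obtain \<beta> where \<beta>: "\<beta> > k" "characteristic_root k \<mu> \<xi>m \<xi>p \<beta>" "l = \<mu> * (\<beta>\<^sup>2 - k\<^sup>2)"
    by blast
  moreover have "\<beta>\<^sup>2 > k\<^sup>2" using k \<beta>(1) by (intro power_strict_mono) auto
  ultimately show "l \<in> {l. l > 0 \<and> characteristic_value k \<mu> (\<xi>m, \<xi>p) l}"
    using \<mu> root_imp_characteristic_value[OF k] by auto
qed

section \<open>Locating the roots\<close>

text \<open>The smaller eigenvalue of the symmetric matrix \<open>[[a, -d], [-d, b]]\<close>. Its sign change detects a zero of the
  determinant even if the determinant itself is positive at both ends.\<close>

definition least_eigenvalue :: "real \<Rightarrow> real \<Rightarrow> real \<Rightarrow> real" where
  "least_eigenvalue a b d = (a + b) / 2 - sqrt (((a - b) / 2)\<^sup>2 + d\<^sup>2)"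

lemma least_eigenvalue_eq_0:
  assumes "least_eigenvalue a b d = 0" shows "a * b = d\<^sup>2"
proof -
  have "((a + b) / 2)\<^sup>2 = (sqrt (((a - b) / 2)\<^sup>2 + d\<^sup>2))\<^sup>2"
    using assms by (simp add: least_eigenvalue_def)
  also have "\<dots> = ((a - b) / 2)\<^sup>2 + d\<^sup>2" by simp
  finally show ?thesis by (simp add: power2_eq_square field_simps)
qed

lemma least_eigenvalue_neg:
  assumes "a * A\<^sup>2 + b * B\<^sup>2 - 2 * d * A * B < 0"
  shows "least_eigenvalue a b d < 0"
proof (rule ccontr)
  assume "\<not> ?thesis"
  then have le: "sqrt (((a - b) / 2)\<^sup>2 + d\<^sup>2) \<le> (a + b) / 2" unfolding least_eigenvalue_def by linarith
  have "0 \<le> sqrt (((a - b) / 2)\<^sup>2 + d\<^sup>2)" by simp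
  then have "0 \<le> (a + b) / 2" using le by (rule order_trans)
  then have tr: "a + b \<ge> 0" by simp
  have "((a - b) / 2)\<^sup>2 + d\<^sup>2 \<le> ((a + b) / 2)\<^sup>2"
    using power_mono[OF le, of 2] by simp
  then have det: "d\<^sup>2 \<le> a * b" by (simp add: power2_eq_square field_simps)
  have "a \<ge> 0"
  proof (rule ccontr)
    assume "\<not> a \<ge> 0"
    then have "a < 0" "b > 0" using tr by auto
    then have "a * b < 0" by (rule mult_neg_pos)
    then show False using det zero_le_power2[of d] by linarith
  qed
  show False
  proof (cases "a = 0")
    case True
    then have "d = 0" using det by simp
    then show False using assms True tr by (simp add: mult_less_0_iff)
  next
    case False
    have "a * (a * A\<^sup>2 + b * B\<^sup>2 - 2 * d * A * B) = (a * A - d * B)\<^sup>2 + (a * b - d\<^sup>2) * B\<^sup>2"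
      by (simp add: power2_eq_square algebra_simps)
    also have "\<dots> \<ge> 0" using det by simp
    finally show False using assms False \<open>a \<ge> 0\<close> by (simp add: zero_le_mult_iff)
  qed
qed

lemma least_eigenvalue_pos:
  assumes "a > \<bar>d\<bar>" "b > \<bar>d\<bar>" shows "least_eigenvalue a b d > 0"
proof -
  have "d\<^sup>2 < a * b"
    using mult_strict_mono'[OF assms] by (simp add: power2_eq_square flip: abs_mult)
  then have "((a - b) / 2)\<^sup>2 + d\<^sup>2 < ((a + b) / 2)\<^sup>2"
    by (simp add: power2_eq_square field_simps)
  then have "sqrt (((a - b) / 2)\<^sup>2 + d\<^sup>2) < sqrt (((a + b) / 2)\<^sup>2)"
    by (rule real_sqrt_less_mono)
  also have "\<dots> = (a + b) / 2" using assms by (simp only: real_sqrt_abs) simp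
  finally show ?thesis by (simp add: least_eigenvalue_def)
qed

lemma stiffness_at_top:
  assumes k: "0 < k"
  shows "filterlim (even_stiffness k) at_top at_top" "filterlim (odd_stiffness k) at_top at_top"
proof -
  have lim: "filterlim (\<lambda>\<beta>. (\<beta>\<^sup>2 - k\<^sup>2) / (c * \<beta>)) at_top at_top" if "c > 0" for c
    using that by real_asymp
  have num: "\<beta>\<^sup>2 - k\<^sup>2 \<ge> 0" if "\<beta> > k" for \<beta>
    using that k by (simp add: power_mono)
  show "filterlim (even_stiffness k) at_top at_top"
  proof (rule filterlim_at_top_mono[OF lim[OF zero_less_one]])
    show "\<forall>\<^sub>F \<beta> in at_top. (\<beta>\<^sup>2 - k\<^sup>2) / (1 * \<beta>) \<le> even_stiffness k \<beta>"
      using eventually_gt_at_top[of k]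
    proof eventually_elim
      case (elim \<beta>)
      have "\<beta> * sinh \<beta> / cosh \<beta> \<le> \<beta>"
        using k elim sinh_less_cosh_real[of \<beta>] by (simp add: pos_divide_le_eq)
      moreover have "0 \<le> k * sinh k / cosh k" using k by simp
      ultimately have "even_slope k \<beta> \<le> 1 * \<beta>" by (simp add: even_slope_def)
      then show ?case
        unfolding even_stiffness_def using num[OF elim] slope_pos[OF k elim] k elim
        by (intro divide_left_mono) auto
    qed
  qed
  have "cosh k / sinh k > 0" using k by simp
  then show "filterlim (odd_stiffness k) at_top at_top"
  proof (rule filterlim_at_top_mono[OF lim])
    show "\<forall>\<^sub>F \<beta> in at_top. (\<beta>\<^sup>2 - k\<^sup>2) / (cosh k / sinh k * \<beta>) \<le> odd_stiffness k \<beta>"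
      using eventually_gt_at_top[of k]
    proof eventually_elim
      case (elim \<beta>)
      have "sinh (\<beta> - k) \<ge> 0" using elim by simp
      then have "cosh \<beta> * sinh k \<le> cosh k * sinh \<beta>" by (simp add: sinh_diff mult_ac)
      then have "cosh \<beta> / sinh \<beta> \<le> cosh k / sinh k"
        using k elim by (simp add: divide_simps)
      then have "\<beta> * (cosh \<beta> / sinh \<beta>) \<le> \<beta> * (cosh k / sinh k)"
        using k elim by (intro mult_left_mono) auto
      moreover have "0 \<le> k * cosh k / sinh k" using k by simp
      ultimately have "odd_slope k \<beta> \<le> cosh k / sinh k * \<beta>"
        unfolding odd_slope_def by (simp add: mult_ac)
      then show ?case
        unfolding odd_stiffness_def using num[OF elim] slope_pos[OF k elim] k elim
        by (intro divide_left_mono) (auto intro!: mult_pos_pos)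
    qed
  qed
qed

text \<open>Both \<open>\<beta>\<^sup>2 - k\<^sup>2\<close> and \<open>f\<close> vanish at \<open>k\<close>, so the quotient tends to the ratio of their derivatives.\<close>

lemma difference_quotient_squares:
  assumes k: "(0::real) < k" and f: "(f has_real_derivative D) (at k)" "f k = 0" and D: "D \<noteq> 0"
  shows "((\<lambda>\<beta>. (\<beta>\<^sup>2 - k\<^sup>2) / f \<beta>) \<longlongrightarrow> 2 * k / D) (at_right k)"
proof -
  have "((\<lambda>\<beta>. (f \<beta> - f k) / (\<beta> - k)) \<longlongrightarrow> D) (at_right k)"
    using f(1) unfolding has_field_derivative_iff by (rule tendsto_mono[rotated]) (rule at_le, simp)
  then have "((\<lambda>\<beta>. (\<beta> + k) / ((f \<beta> - f k) / (\<beta> - k))) \<longlongrightarrow> (k + k) / D) (at_right k)"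
    by (intro tendsto_intros D)
  moreover have "\<forall>\<^sub>F \<beta> in at_right k. (\<beta> + k) / ((f \<beta> - f k) / (\<beta> - k)) = (\<beta>\<^sup>2 - k\<^sup>2) / f \<beta>"
    unfolding eventually_at_filter
    by (rule always_eventually) (simp add: f(2) power2_eq_square algebra_simps)
  ultimately show ?thesis
    by (simp add: tendsto_cong)
qed

text \<open>As \<open>\<beta>\<close> approaches \<open>k\<close>, the simple roots \<open>k\<close> and \<open>\<beta>\<close> merge and the boundary value problem turns into the
  variational problem of the critical viscosity.\<close>

lemma stiffness_at_right:
  assumes k: "0 < k"
  shows "(even_stiffness k \<longlongrightarrow> 1 / even_compliance k) (at_right k)"
    "(odd_stiffness k \<longlongrightarrow> 1 / odd_compliance k) (at_right k)"
proof -
  have pos: "(sinh k * cosh k + k) / (cosh k)\<^sup>2 \<noteq> 0" "(sinh k * cosh k - k) / (sinh k)\<^sup>2 \<noteq> 0"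
    using k less_sinh_cosh[OF k] by auto
  show "(even_stiffness k \<longlongrightarrow> 1 / even_compliance k) (at_right k)"
    using difference_quotient_squares[OF k has_derivative_even_slope _ pos(1)]
    unfolding even_stiffness_def[abs_def] even_compliance_def
    by (simp add: even_slope_def)
  show "(odd_stiffness k \<longlongrightarrow> 1 / odd_compliance k) (at_right k)"
    using difference_quotient_squares[OF k has_derivative_odd_slope[OF k] _ pos(2)]
    unfolding odd_stiffness_def[abs_def] odd_compliance_def
    by (simp add: odd_slope_def)
qed

text \<open>The quadratic form of the matrix has a negative value near \<open>\<beta> = k\<close>, since there it is close to the matrix of the variational
  problem, and it is positive definite for large \<open>\<beta>\<close>; its least eigenvalue depends continuously on \<open>\<beta>\<close>.\<close>

lemma characteristic_root_exists:
  assumes k: "0 < k" and \<mu>: "0 < \<mu>" "\<mu> < critical_viscosity k (\<xi>m, \<xi>p)"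
  shows "\<exists>\<beta>>k. characteristic_root k \<mu> \<xi>m \<xi>p \<beta>"
proof -
  define a where "a \<beta> = 2 * \<mu> * even_stiffness k \<beta> - (\<xi>p + \<xi>m)" for \<beta>
  define b where "b \<beta> = 2 * \<mu> * odd_stiffness k \<beta> - (\<xi>p + \<xi>m)" for \<beta>
  define d where "d = \<xi>p - \<xi>m"
  define m where "m \<beta> = least_eigenvalue (a \<beta>) (b \<beta>) d" for \<beta>
  obtain A B where AB: "\<mu> * boundary_energy k A B < \<xi>p * (A + B)\<^sup>2 + \<xi>m * (B - A)\<^sup>2"
    by (rule critical_viscosity_direction[OF k \<mu>])
  define Q where "Q \<beta> = a \<beta> * A\<^sup>2 + b \<beta> * B\<^sup>2 - 2 * d * A * B" for \<beta>
  have "(Q \<longlongrightarrow> (2 * \<mu> * (1 / even_compliance k) - (\<xi>p + \<xi>m)) * A\<^sup>2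
      + (2 * \<mu> * (1 / odd_compliance k) - (\<xi>p + \<xi>m)) * B\<^sup>2 - 2 * d * A * B) (at_right k)"
    unfolding Q_def a_def b_def by (intro tendsto_intros stiffness_at_right[OF k])
  also have "(2 * \<mu> * (1 / even_compliance k) - (\<xi>p + \<xi>m)) * A\<^sup>2
      + (2 * \<mu> * (1 / odd_compliance k) - (\<xi>p + \<xi>m)) * B\<^sup>2 - 2 * d * A * B
      = \<mu> * boundary_energy k A B - (\<xi>p * (A + B)\<^sup>2 + \<xi>m * (B - A)\<^sup>2)"
    by (simp add: boundary_energy_def d_def power2_eq_square algebra_simps)
  finally have "(Q \<longlongrightarrow> \<mu> * boundary_energy k A B - (\<xi>p * (A + B)\<^sup>2 + \<xi>m * (B - A)\<^sup>2)) (at_right k)" .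
  then have "\<forall>\<^sub>F \<beta> in at_right k. Q \<beta> < 0" by (rule order_tendstoD(2)) (use AB in simp)
  then have "\<forall>\<^sub>F \<beta> in at_right k. k < \<beta> \<and> Q \<beta> < 0"
    using eventually_at_right_less[of k] by eventually_elim auto
  then obtain \<beta>0 where \<beta>0: "k < \<beta>0" "Q \<beta>0 < 0"
    by (metis (mono_tags, lifting) eventually_happens trivial_limit_at_right_real)
  then have m0: "m \<beta>0 < 0" unfolding m_def Q_def by (intro least_eigenvalue_neg)
  have "filterlim a at_top at_top" "filterlim b at_top at_top"
    unfolding a_def b_def diff_conv_add_uminus
    using \<mu>(1) stiffness_at_top[OF k]
    by (auto intro!: filterlim_tendsto_add_at_top[OF tendsto_const] filterlim_tendsto_pos_mult_at_top[OF tendsto_const]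
        simp: add.commute[of "_ * _"])
  then have "\<forall>\<^sub>F \<beta> in at_top. \<bar>d\<bar> < a \<beta>" "\<forall>\<^sub>F \<beta> in at_top. \<bar>d\<bar> < b \<beta>"
    unfolding filterlim_at_top_dense by auto
  then have "\<forall>\<^sub>F \<beta> in at_top. \<beta>0 \<le> \<beta> \<and> 0 < m \<beta>"
    using eventually_ge_at_top[of \<beta>0]
    by eventually_elim (auto simp: m_def least_eigenvalue_pos)
  then obtain \<beta>1 where \<beta>1: "\<beta>0 \<le> \<beta>1" "0 < m \<beta>1"
    using eventually_happens'[OF trivial_limit_at_top_linorder] by blast
  have "continuous_on {\<beta>0..\<beta>1} (even_slope k)" "continuous_on {\<beta>0..\<beta>1} (odd_slope k)"
    unfolding even_slope_def odd_slope_def using k \<beta>0(1) by (auto intro!: continuous_intros)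
  moreover have "even_slope k \<beta> \<noteq> 0" "odd_slope k \<beta> \<noteq> 0" if "\<beta> \<in> {\<beta>0..\<beta>1}" for \<beta>
    using slope_pos[OF k, of \<beta>] that \<beta>0(1) by auto
  ultimately have "continuous_on {\<beta>0..\<beta>1} m"
    unfolding m_def least_eigenvalue_def a_def b_def even_stiffness_def odd_stiffness_def
    by (intro continuous_intros) auto
  then obtain \<beta> where "\<beta>0 \<le> \<beta>" "m \<beta> = 0"
    using IVT'[of m \<beta>0 0 \<beta>1] m0 \<beta>1 by auto
  then show ?thesis
    using \<beta>0(1) least_eigenvalue_eq_0[of "a \<beta>" "b \<beta>" d]
    unfolding characteristic_root_def m_def a_def b_def d_def by (intro exI[of _ \<beta>]) auto
qed

text \<open>Clearing the denominators \<open>p cosh \<beta>\<close> and \<open>q sinh \<beta>\<close>, where \<open>p\<close> and \<open>q\<close> are the slopes, turns the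
  determinant into an entire function \<open>G\<close>. It is not constant because it vanishes at the origin but not at large
  real arguments, which also bounds the roots.\<close>

lemma finite_characteristic_roots:
  assumes k: "0 < k" and \<mu>: "0 < \<mu>"
  shows "finite {\<beta>. \<beta> > k \<and> characteristic_root k \<mu> \<xi>m \<xi>p \<beta>}"
proof -
  define S where "S = \<xi>p + \<xi>m"
  define d where "d = \<xi>p - \<xi>m"
  define e where "e = k * sinh k / cosh k"
  define o' where "o' = k * cosh k / sinh k"
  define p :: "complex \<Rightarrow> complex" where "p z = z * sinh z - of_real e * cosh z" for z
  define q :: "complex \<Rightarrow> complex" where "q z = z * cosh z - of_real o' * sinh z" for z
  define G where "G z = (2 * of_real \<mu> * (z\<^sup>2 - of_real (k\<^sup>2)) * cosh z - of_real S * p z)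
      * (2 * of_real \<mu> * (z\<^sup>2 - of_real (k\<^sup>2)) * sinh z - of_real S * q z) - of_real (d\<^sup>2) * p z * q z" for z
  have hol: "G holomorphic_on UNIV"
    unfolding G_def p_def q_def sinh_field_def cosh_field_def by (intro holomorphic_intros) auto
  have sinh_of_real: "sinh (of_real x :: complex) = of_real (sinh x)"
    and cosh_of_real: "cosh (of_real x :: complex) = of_real (cosh x)" for x
    by (simp_all add: sinh_field_def cosh_field_def flip: exp_of_real)
  have p: "p (of_real \<beta>) = of_real (even_slope k \<beta> * cosh \<beta>)" for \<beta> :: real
    by (simp add: p_def even_slope_def e_def left_diff_distrib sinh_of_real cosh_of_real)
  have q: "q (of_real \<beta>) = of_real (odd_slope k \<beta> * sinh \<beta>)" if "\<beta> > k" for \<beta> :: real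
    using that k by (simp add: q_def odd_slope_def o'_def left_diff_distrib sinh_of_real cosh_of_real)
  have root: "G (of_real \<beta>) = 0 \<longleftrightarrow> characteristic_root k \<mu> \<xi>m \<xi>p \<beta>" if \<beta>: "\<beta> > k" for \<beta>
  proof -
    note pos = slope_pos[OF k \<beta>]
    define ps where "ps = even_slope k \<beta>"
    define qs where "qs = odd_slope k \<beta>"
    define s where "s = \<beta>\<^sup>2 - k\<^sup>2"
    have "G (of_real \<beta>) = of_real ((2 * \<mu> * s * cosh \<beta> - S * (ps * cosh \<beta>))
        * (2 * \<mu> * s * sinh \<beta> - S * (qs * sinh \<beta>)) - d\<^sup>2 * (ps * cosh \<beta>) * (qs * sinh \<beta>))"
      unfolding G_def p q[OF \<beta>] ps_def qs_def s_def by (simp add: sinh_of_real cosh_of_real)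
    also have "(2 * \<mu> * s * cosh \<beta> - S * (ps * cosh \<beta>))
        * (2 * \<mu> * s * sinh \<beta> - S * (qs * sinh \<beta>)) - d\<^sup>2 * (ps * cosh \<beta>) * (qs * sinh \<beta>)
      = ps * qs * cosh \<beta> * sinh \<beta> * ((2 * \<mu> * (s / ps) - S) * (2 * \<mu> * (s / qs) - S) - d\<^sup>2)"
      using pos unfolding ps_def[symmetric] qs_def[symmetric] by (simp add: field_simps)
    finally have "G (of_real \<beta>) = of_real (ps * qs * cosh \<beta> * sinh \<beta>
        * ((2 * \<mu> * (s / ps) - S) * (2 * \<mu> * (s / qs) - S) - d\<^sup>2))" .
    then have "G (of_real \<beta>) = 0 \<longleftrightarrow> ps * qs * cosh \<beta> * sinh \<beta>
        * ((2 * \<mu> * (s / ps) - S) * (2 * \<mu> * (s / qs) - S) - d\<^sup>2) = 0"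
      by (simp only: of_real_eq_0_iff)
    then show ?thesis
      using pos k \<beta> by (simp add: characteristic_root_def even_stiffness_def odd_stiffness_def
          ps_def qs_def s_def S_def d_def)
  qed
  have "filterlim (\<lambda>\<beta>. 2 * \<mu> * even_stiffness k \<beta>) at_top at_top"
    "filterlim (\<lambda>\<beta>. 2 * \<mu> * odd_stiffness k \<beta>) at_top at_top"
    using \<mu> stiffness_at_top[OF k]
    by (auto intro!: filterlim_tendsto_pos_mult_at_top[OF tendsto_const])
  then have "\<forall>\<^sub>F \<beta> in at_top. \<bar>d\<bar> + S < 2 * \<mu> * even_stiffness k \<beta>"
    "\<forall>\<^sub>F \<beta> in at_top. \<bar>d\<bar> + S < 2 * \<mu> * odd_stiffness k \<beta>"
    unfolding filterlim_at_top_dense by auto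
  then have "\<forall>\<^sub>F \<beta> in at_top. \<not> characteristic_root k \<mu> \<xi>m \<xi>p \<beta>"
  proof eventually_elim
    case (elim \<beta>)
    then have "\<bar>d\<bar> * \<bar>d\<bar> < (2 * \<mu> * even_stiffness k \<beta> - S) * (2 * \<mu> * odd_stiffness k \<beta> - S)"
      by (intro mult_strict_mono') auto
    then show ?case
      by (simp add: characteristic_root_def S_def d_def power2_eq_square flip: abs_mult)
  qed
  then obtain R where R: "\<And>\<beta>. \<beta> \<ge> R \<Longrightarrow> \<not> characteristic_root k \<mu> \<xi>m \<xi>p \<beta>"
    unfolding eventually_at_top_linorder by blast
  have "\<not> G constant_on UNIV"
  proof
    assume "G constant_on UNIV"
    then have "G (of_real (max R (k + 1))) = G 0"
      unfolding constant_on_def by auto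
    also have "G 0 = 0" by (simp add: G_def q_def)
    finally show False using root[of "max R (k + 1)"] R[of "max R (k + 1)"] by simp
  qed
  then have "finite {z \<in> cball 0 R. G z = 0}"
    by (intro holomorphic_compact_finite_zeros[OF hol]) auto
  moreover have "of_real ` {\<beta>. \<beta> > k \<and> characteristic_root k \<mu> \<xi>m \<xi>p \<beta>} \<subseteq> {z \<in> cball 0 R. G z = 0}"
  proof safe
    fix \<beta> :: real assume \<beta>: "\<beta> > k" "characteristic_root k \<mu> \<xi>m \<xi>p \<beta>"
    then show "(of_real \<beta> :: complex) \<in> cball 0 R"
      using R[of \<beta>] k by (cases "\<beta> \<ge> R") auto
    show "G (of_real \<beta>) = 0" using root \<beta> by simp
  qed
  ultimately show ?thesis
    by (meson finite_imageD finite_subset inj_of_real inj_on_subset subset_UNIV)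
qed

lemma strictly_decreasing_enumeration:
  fixes S :: "real set"
  assumes "finite S" "S \<noteq> {}"
  shows "\<exists>(M::nat) (lam :: nat \<Rightarrow> real). 1 \<le> M \<and> (\<forall>i\<in>{1..M}. \<forall>j\<in>{1..M}. i < j \<longrightarrow> lam i > lam j) \<and> lam ` {1..M} = S"
proof -
  define xs where "xs = rev (sorted_list_of_set S)"
  have set: "set xs = S" using assms(1) by (simp add: xs_def)
  have sorted: "sorted_wrt (>) xs"
    using strict_sorted_list_of_set[of S] by (simp add: xs_def sorted_wrt_rev)
  define lam where "lam j = xs ! (j - 1)" for j
  have "lam ` {1..length xs} = (!) xs ` ((\<lambda>j. j - 1) ` {1..length xs})"
    unfolding lam_def image_image ..
  also have "(\<lambda>j. j - 1) ` {1..length xs} = {..<length xs}"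
  proof (intro set_eqI iffI)
    fix i assume "i \<in> {..<length xs}"
    then show "i \<in> (\<lambda>j. j - 1) ` {1..length xs}" by (intro image_eqI[of _ _ "Suc i"]) auto
  qed auto
  also have "(!) xs ` {..<length xs} = S"
    using set by (auto simp: set_conv_nth)
  finally have "lam ` {1..length xs} = S" .
  moreover have "1 \<le> length xs" using set assms(2) by (cases xs) auto
  moreover have "lam i > lam j" if "i \<in> {1..length xs}" "j \<in> {1..length xs}" "i < j" for i j
    unfolding lam_def by (rule sorted_wrt_nth_less[OF sorted]) (use that in auto)
  ultimately show ?thesis by (intro exI[of _ "length xs"] exI[of _ lam]) simp
qed

lemma abs_wavenumber:
  "critical_viscosity \<bar>k\<bar> \<Xi> = critical_viscosity k \<Xi>"
  "solves_bvp \<bar>k\<bar> \<mu> \<Xi> l \<phi> \<longleftrightarrow> solves_bvp k \<mu> \<Xi> l \<phi>"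
  by (simp_all add: critical_viscosity_def rayleigh_quotient_def solves_bvp_def)

theorem theorem2p1:
  fixes L \<xi>p \<xi>m k \<mu> :: real
  assumes "L > 0"
    and "k \<in> range (\<lambda>n::int. of_int n / L) - {0}"
    and "\<mu> \<in> {0<..<critical_viscosity k (\<xi>m, \<xi>p)}"
  shows "\<exists>(M::nat) (lam :: nat \<Rightarrow> real).
    1 \<le> M \<and>
    (\<forall>i\<in>{1..M}. \<forall>j\<in>{1..M}. i < j \<longrightarrow> lam i > lam j) \<and>
    lam M > 0 \<and>
    lam ` {1..M} = {l. l > 0 \<and> characteristic_value k \<mu> (\<xi>m, \<xi>p) l} \<and>
    (\<forall>j\<in>{1..M}. \<exists>\<phi> \<in> sobolev 4. nonzero_I \<phi> \<and> solves_bvp k \<mu> (\<xi>m, \<xi>p) (lam j) \<phi>)"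
proof -
  let ?S = "{l. l > 0 \<and> characteristic_value k \<mu> (\<xi>m, \<xi>p) l}"
  have k: "\<bar>k\<bar> > 0" and \<mu>: "0 < \<mu>" "\<mu> < critical_viscosity \<bar>k\<bar> (\<xi>m, \<xi>p)"
    using assms(2,3) by (auto simp: abs_wavenumber)
  have S: "?S = (\<lambda>\<beta>. \<mu> * (\<beta>\<^sup>2 - \<bar>k\<bar>\<^sup>2)) ` {\<beta>. \<beta> > \<bar>k\<bar> \<and> characteristic_root \<bar>k\<bar> \<mu> \<xi>m \<xi>p \<beta>}"
    using positive_characteristic_values[OF k \<mu>(1)]
    by (simp add: characteristic_value_def abs_wavenumber)
  have "finite ?S" unfolding S by (intro finite_imageI finite_characteristic_roots[OF k \<mu>(1)])
  moreover have "?S \<noteq> {}" unfolding S using characteristic_root_exists[OF k \<mu>] by auto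
  ultimately have "\<exists>(M::nat) (lam :: nat \<Rightarrow> real). 1 \<le> M \<and>
      (\<forall>i\<in>{1..M}. \<forall>j\<in>{1..M}. i < j \<longrightarrow> lam i > lam j) \<and> lam ` {1..M} = ?S"
    by (rule strictly_decreasing_enumeration)
  then show ?thesis
  proof (elim exE conjE)
    fix M :: nat and lam :: "nat \<Rightarrow> real"
    assume M: "1 \<le> M" "\<forall>i\<in>{1..M}. \<forall>j\<in>{1..M}. i < j \<longrightarrow> lam i > lam j" "lam ` {1..M} = ?S"
    have "lam j \<in> ?S" if "j \<in> {1..M}" for j using M(3) that by blast
    then have "\<forall>j\<in>{1..M}. lam j > 0 \<and> (\<exists>\<phi> \<in> sobolev 4. nonzero_I \<phi> \<and> solves_bvp k \<mu> (\<xi>m, \<xi>p) (lam j) \<phi>)"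
      unfolding characteristic_value_def by auto
    then show ?thesis using M by (intro exI[of _ M] exI[of _ lam]) auto
  qed
qed

end
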